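(* Let $n\ge 1$ and let $D$ be a probability distribution on pairs $k=(k_1,k_2)\in\{0,1\}^n\times\{0,1\}^n$ such that the marginal distribution of $k_1$ and the marginal distribution of $k_2$ are each uniform on $\{0,1\}^n$ (no independence of $k_1$ and $k_2$ is assumed). For a permutation $P$ of $\{0,1\}^n$ let $E_k[P](x)=P(x\oplus k_1)\oplus k_2$. Let $\mathcal A$ be a quantum algorithm making $q_E$ classical queries to its first oracle (forward and inverse queries counted together) and $q_P$ quantum queries to its second oracle (forward and inverse queries counted together). Then $$\left|\Pr_{k\leftarrow D,\;P\leftarrow\mathcal P_n}\left[\mathcal A^{E_k[P],P}(1^n)=1\right]-\Pr_{R,P\leftarrow\mathcal P_n}\left[\mathcal A^{R,P}(1^n)=1\right]\right|\le 10\cdot 2^{-n/2}\left(q_E\sqrt{q_P}+q_P\sqrt{q_E}\right),$$ where in the first probability $P$ is a uniform permutation independent of $k$, and in the second $R,P$ are independent uniform permutations.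
   Context: $\mathcal P_n$ is the set of all permutations of $\{0,1\}^n$, and $x\leftarrow\mathcal P_n$ denotes uniform sampling. $\mathcal A^{O_1,O_2}$ denotes an execution of a (computationally unbounded) quantum algorithm with two oracles, both permutations of $\{0,1\}^n$ and both accessible in the forward and inverse directions. Access to $O_1$ is classical: each query is a classical string $x$ and a direction, and the answer is $O_1(x)$ or $O_1^{-1}(x)$. Access to $O_2$ is quantum: each query applies the unitary $|x\rangle|y\rangle\mapsto|x\rangle|y\oplus O_2(x)\rangle$ or $|x\rangle|y\rangle\mapsto|x\rangle|y\oplus O_2^{-1}(x)\rangle$ to registers chosen by $\mathcal A$. $\mathcal A$ may make intermediate measurements, and may choose adaptively, based on measurement outcomes and earlier answers, which queries to make and how to interleave classical and quantum queries. Probabilities are also over $\mathcal A$'s measurement outcomes. *)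

theory Defs
  imports "HOL-Probability.Probability"
begin

section \<open>Bit strings, permutations and the Even-Mansour construction\<close>

text \<open>
  The set of n-bit strings is the function type from a finite index type of n elements to the
  Booleans, so that n is the cardinality of the index type.
\<close>

type_synonym 'n bits = "'n \<Rightarrow> bool"

definition xor_bits :: "'n bits \<Rightarrow> 'n bits \<Rightarrow> 'n bits" (infixl "\<oplus>" 65)
  where "x \<oplus> y = (\<lambda>i. x i \<noteq> y i)"

definition perms :: "('n bits \<Rightarrow> 'n bits) set"
  where "perms = {P. bij P}"

definition even_mansour :: "'n bits \<Rightarrow> 'n bits \<Rightarrow> ('n bits \<Rightarrow> 'n bits) \<Rightarrow> 'n bits \<Rightarrow> 'n bits"
  where "even_mansour k1 k2 P x = P (x \<oplus> k1) \<oplus> k2"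

datatype direction = Forward | Inverse

fun directed :: "direction \<Rightarrow> ('a \<Rightarrow> 'a) \<Rightarrow> 'a \<Rightarrow> 'a" where
  "directed Forward P = P"
| "directed Inverse P = inv P"


section \<open>States, measurements and oracle unitaries\<close>

text \<open>
  The memory of an algorithm consists of finitely many qubits labelled by the elements of a
  finite type. The computational basis is indexed by the assignments of Booleans to labels.
\<close>

type_synonym 'w state = "complex ^ ('w \<Rightarrow> bool)"
type_synonym 'w operator = "complex ^ ('w \<Rightarrow> bool) ^ ('w \<Rightarrow> bool)"

definition zero_state :: "'w::finite state"
  where "zero_state = axis (\<lambda>_. False) 1"

definition dagger :: "'w::finite operator \<Rightarrow> 'w operator"
  where "dagger A = (\<chi> s t. cnj (A $ t $ s))"

text \<open>
  General measurements with outcomes below \<open>m\<close>. The case \<open>m = 1\<close> is exactly the application of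
  a unitary, and measurement operators that are multiples of the identity give coin tosses.
\<close>

definition complete_measurement :: "nat \<Rightarrow> (nat \<Rightarrow> 'w::finite operator) \<Rightarrow> bool"
  where "complete_measurement m M \<longleftrightarrow> (\<Sum>i<m. dagger (M i) ** M i) = mat 1"

text \<open>
  The Born rule. This is meaningful only for complete measurements and unit vectors (see
  \<open>pmf_measurement_outcome\<close> below); unit norm is preserved by the steps of an algorithm.
\<close>

definition measurement_outcome :: "nat \<Rightarrow> (nat \<Rightarrow> 'w::finite operator) \<Rightarrow> 'w state \<Rightarrow> nat pmf"
  where "measurement_outcome m M \<psi> = embed_pmf (\<lambda>i. if i < m then (norm (M i *v \<psi>))\<^sup>2 else 0)"

definition post_measurement :: "'w::finite operator \<Rightarrow> 'w state \<Rightarrow> 'w state"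
  where "post_measurement A \<psi> = (1 / norm (A *v \<psi>)) *\<^sub>R (A *v \<psi>)"

text \<open>
  Bit \<open>j\<close> of the input register is the qubit \<open>rx j\<close>, and bit \<open>j\<close> of the output register is the
  qubit \<open>ry j\<close>. On basis states the query XORs \<open>f\<close> of the input register into the output
  register; the remaining qubits are unchanged.
\<close>

definition query_basis ::
    "('n bits \<Rightarrow> 'n bits) \<Rightarrow> ('n \<Rightarrow> 'w) \<Rightarrow> ('n \<Rightarrow> 'w) \<Rightarrow> ('w \<Rightarrow> bool) \<Rightarrow> ('w \<Rightarrow> bool)"
  where "query_basis f rx ry s =
    (\<lambda>w. if w \<in> range ry then ((s \<circ> ry) \<oplus> f (s \<circ> rx)) (inv ry w) else s w)"

definition disjoint_registers :: "('n \<Rightarrow> 'w) \<Rightarrow> ('n \<Rightarrow> 'w) \<Rightarrow> bool"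
  where "disjoint_registers rx ry \<longleftrightarrow> inj rx \<and> inj ry \<and> range rx \<inter> range ry = {}"

definition query_unitary ::
    "('n bits \<Rightarrow> 'n bits) \<Rightarrow> ('n \<Rightarrow> 'w::finite) \<Rightarrow> ('n \<Rightarrow> 'w) \<Rightarrow> 'w operator"
  where "query_unitary f rx ry = (\<chi> t s. if t = query_basis f rx ry s then 1 else 0)"


section \<open>Quantum algorithms with a classical and a quantum oracle\<close>

text \<open>
  An algorithm is a well-founded tree. Its branching on measurement outcomes and on classical
  oracle answers expresses adaptivity, both in the queries made and in their order.
  The continuations of \<open>Measure m M K\<close> at indices \<open>i \<ge> m\<close> are never used.
\<close>

datatype ('n, 'w::finite) qalg =
    Output bool
  | Measure nat "nat \<Rightarrow> 'w operator" "nat \<Rightarrow> ('n, 'w) qalg"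
  | ClassicalQuery direction "'n bits" "'n bits \<Rightarrow> ('n, 'w) qalg"
  | QuantumQuery direction "'n \<Rightarrow> 'w" "'n \<Rightarrow> 'w" "('n, 'w) qalg"

primrec well_formed :: "('n, 'w::finite) qalg \<Rightarrow> bool" where
  "well_formed (Output b) \<longleftrightarrow> True"
| "well_formed (Measure m M K) \<longleftrightarrow> complete_measurement m M \<and> (\<forall>i<m. well_formed (K i))"
| "well_formed (ClassicalQuery d x K) \<longleftrightarrow> (\<forall>y. well_formed (K y))"
| "well_formed (QuantumQuery d rx ry A) \<longleftrightarrow> disjoint_registers rx ry \<and> well_formed A"

text \<open>
  \<open>makes_queries A qE qP\<close>: on every branch there are at most \<open>qE\<close> classical and at most \<open>qP\<close>
  quantum queries.
\<close>

primrec makes_queries :: "('n, 'w::finite) qalg \<Rightarrow> nat \<Rightarrow> nat \<Rightarrow> bool" where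
  "makes_queries (Output b) qE qP \<longleftrightarrow> True"
| "makes_queries (Measure m M K) qE qP \<longleftrightarrow> (\<forall>i<m. makes_queries (K i) qE qP)"
| "makes_queries (ClassicalQuery d x K) qE qP \<longleftrightarrow> qE > 0 \<and> (\<forall>y. makes_queries (K y) (qE - 1) qP)"
| "makes_queries (QuantumQuery d rx ry A) qE qP \<longleftrightarrow> qP > 0 \<and> makes_queries A qE (qP - 1)"

primrec run_from ::
    "('n, 'w::finite) qalg \<Rightarrow> ('n bits \<Rightarrow> 'n bits) \<Rightarrow> ('n bits \<Rightarrow> 'n bits) \<Rightarrow> 'w state \<Rightarrow> bool pmf"
where
  "run_from (Output b) O1 O2 \<psi> = return_pmf b"
| "run_from (Measure m M K) O1 O2 \<psi> =
     bind_pmf (measurement_outcome m M \<psi>) (\<lambda>i. run_from (K i) O1 O2 (post_measurement (M i) \<psi>))"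
| "run_from (ClassicalQuery d x K) O1 O2 \<psi> = run_from (K (directed d O1 x)) O1 O2 \<psi>"
| "run_from (QuantumQuery d rx ry A) O1 O2 \<psi> =
     run_from A O1 O2 (query_unitary (directed d O2) rx ry *v \<psi>)"

definition run :: "('n, 'w::finite) qalg \<Rightarrow> ('n bits \<Rightarrow> 'n bits) \<Rightarrow> ('n bits \<Rightarrow> 'n bits) \<Rightarrow> bool pmf"
  where "run A O1 O2 = run_from A O1 O2 zero_state"


section \<open>The two experiments\<close>

definition real_experiment :: "('n bits \<times> 'n bits) pmf \<Rightarrow> ('n, 'w::finite) qalg \<Rightarrow> bool pmf"
  where "real_experiment D A =
    bind_pmf D (\<lambda>(k1, k2). bind_pmf (pmf_of_set perms) (\<lambda>P. run A (even_mansour k1 k2 P) P))"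

definition ideal_experiment :: "('n, 'w::finite) qalg \<Rightarrow> bool pmf"
  where "ideal_experiment A =
    bind_pmf (pmf_of_set perms) (\<lambda>R. bind_pmf (pmf_of_set perms) (\<lambda>P. run A R P))"


section \<open>Soundness of the execution semantics\<close>

lemma norm_sq_state: "complex_of_real ((norm (\<psi> :: 'w::finite state))\<^sup>2) = (\<Sum>s\<in>UNIV. cnj (\<psi> $ s) * \<psi> $ s)"
proof -
  have "(norm \<psi>)\<^sup>2 = (\<Sum>s\<in>UNIV. (norm (\<psi> $ s))\<^sup>2)"
    by (simp add: norm_vec_def L2_set_def sum_nonneg)
  thus ?thesis
    by (simp only: of_real_sum complex_norm_square mult.commute)
qed

lemma norm_sq_mult:
  fixes A :: "'w::finite operator"
  shows "complex_of_real ((norm (A *v \<psi>))\<^sup>2) = (\<Sum>s\<in>UNIV. cnj (\<psi> $ s) * ((dagger A ** A) *v \<psi>) $ s)"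
proof -
  have "(\<Sum>s\<in>UNIV. cnj (\<psi> $ s) * (dagger A *v \<phi>) $ s) = (\<Sum>t\<in>UNIV. cnj ((A *v \<psi>) $ t) * \<phi> $ t)" for \<phi>
    unfolding matrix_vector_mult_def dagger_def
    by (simp add: sum_distrib_left sum_distrib_right cnj_sum) (subst sum.swap, simp add: mult_ac)
  from this[of "A *v \<psi>"] show ?thesis
    by (simp only: norm_sq_state matrix_vector_mul_assoc)
qed

lemma complete_measurement_norm:
  assumes "complete_measurement m (M :: nat \<Rightarrow> 'w::finite operator)"
  shows "(\<Sum>i<m. (norm (M i *v \<psi>))\<^sup>2) = (norm \<psi>)\<^sup>2"
proof -
  have sum_mv: "(\<Sum>i<m. B i *v \<psi>) = (\<Sum>i<m. B i) *v \<psi>" for B :: "nat \<Rightarrow> 'w operator"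
    by (induction m) (simp_all add: matrix_vector_mult_add_rdistrib)
  have "complex_of_real (\<Sum>i<m. (norm (M i *v \<psi>))\<^sup>2) =
      (\<Sum>i<m. \<Sum>s\<in>UNIV. cnj (\<psi> $ s) * ((dagger (M i) ** M i) *v \<psi>) $ s)"
    by (simp only: of_real_sum norm_sq_mult)
  also have "\<dots> = (\<Sum>s\<in>UNIV. cnj (\<psi> $ s) * (\<Sum>i<m. (dagger (M i) ** M i) *v \<psi>) $ s)"
    by (subst sum.swap) (simp add: sum_distrib_left)
  also have "\<dots> = complex_of_real ((norm \<psi>)\<^sup>2)"
    using assms by (simp only: sum_mv norm_sq_state complete_measurement_def matrix_vector_mul_lid)
  finally show ?thesis
    by (simp only: of_real_eq_iff)
qed

lemma pmf_measurement_outcome: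
  assumes "complete_measurement m M" and "norm \<psi> = 1"
  shows "pmf (measurement_outcome m M \<psi>) i = (if i < m then (norm (M i *v \<psi>))\<^sup>2 else 0)"
  unfolding measurement_outcome_def
proof (rule pmf_embed_pmf)
  let ?f = "\<lambda>i. if i < m then (norm (M i *v \<psi>))\<^sup>2 else 0"
  have "(\<integral>\<^sup>+ i. ennreal (?f i) \<partial>count_space UNIV) = (\<Sum>i<m. ennreal (?f i))"
    by (rule nn_integral_count_space'[where A = "{..<m}"]) auto
  also have "\<dots> = ennreal (\<Sum>i<m. ?f i)"
    by (intro sum_ennreal) simp
  also have "(\<Sum>i<m. ?f i) = 1"
    using complete_measurement_norm[OF assms(1), of \<psi>] assms(2) by simp
  finally show "(\<integral>\<^sup>+ i. ennreal (?f i) \<partial>count_space UNIV) = 1"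
    by simp
qed simp

lemma norm_post_measurement: "A *v \<psi> \<noteq> 0 \<Longrightarrow> norm (post_measurement A \<psi>) = 1"
  by (simp add: post_measurement_def)

lemma norm_zero_state: "norm zero_state = 1"
  by (simp add: zero_state_def)

lemma query_basis_involution:
  assumes "disjoint_registers rx ry"
  shows "query_basis f rx ry (query_basis f rx ry s) = s"
proof -
  have rx: "query_basis f rx ry s \<circ> rx = s \<circ> rx"
    using assms by (auto simp: query_basis_def disjoint_registers_def fun_eq_iff)
  have ry: "query_basis f rx ry s \<circ> ry = (s \<circ> ry) \<oplus> f (s \<circ> rx)"
    using assms by (auto simp: query_basis_def disjoint_registers_def fun_eq_iff)
  show ?thesis
  proof
    fix w
    show "query_basis f rx ry (query_basis f rx ry s) w = s w"
      unfolding query_basis_def[of f rx ry "query_basis f rx ry s"] rx ry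
      by (auto simp: xor_bits_def query_basis_def f_inv_into_f)
  qed
qed

lemma norm_query_unitary:
  assumes "disjoint_registers rx ry"
  shows "norm (query_unitary f rx ry *v \<psi>) = norm \<psi>"
proof -
  let ?q = "query_basis f rx ry"
  have q: "?q (?q s) = s" for s
    by (rule query_basis_involution[OF assms])
  have eq: "t = ?q s \<longleftrightarrow> s = ?q t" for s t
    using q by metis
  have "(query_unitary f rx ry *v \<psi>) $ t = \<psi> $ ?q t" for t
    by (simp add: query_unitary_def matrix_vector_mult_def eq if_distrib[where f = "\<lambda>z. z * _"] cong: if_cong)
  moreover have "(\<Sum>t\<in>UNIV. (norm (\<psi> $ ?q t))\<^sup>2) = (\<Sum>t\<in>UNIV. (norm (\<psi> $ t))\<^sup>2)"
    by (rule sum.reindex_bij_witness[of _ ?q ?q]) (simp_all add: q)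
  ultimately show ?thesis
    by (simp add: norm_vec_def L2_set_def)
qed

end

theory Submission
  imports Defs
begin

text \<open>
  The classical queries are first answered by \<open>R\<close> and the quantum queries by \<open>P\<close>. At some point a key
  \<open>k\<close> is sampled, \<open>P\<close> is reprogrammed to a permutation \<open>P'\<close> such that \<open>E\<^sub>k[P']\<close> agrees with the transcript
  so far, and \<open>E\<^sub>k[P']\<close> and \<open>P'\<close> are used for the remaining queries. This switch is moved over one query
  at a time. Moving it over a quantum query costs little, because with \<open>j\<close> classical queries so far
  every point is reprogrammed with probability at most \<open>2 j / 2\<^sup>n\<close>. Moving it over a classical query
  resamples the value of \<open>P'\<close> at a uniformly random point, namely the query shifted by the key. By an
  exchange of values this becomes a change of \<open>P\<close> in the state computed before, whose amplitudes are
  polynomials of degree at most \<open>q\<close> in the indicators of \<open>P a = b\<close> after \<open>q\<close> quantum queries. For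
  fixed \<open>c\<close> the exchanges of the values at \<open>s\<close> and \<open>s \<oplus> c\<close> commute, and as for Boolean functions of
  low degree the total influence of all of them is linear in \<open>q\<close>. A random exchange therefore moves
  the state only by a distance of order \<open>sqrt (q / 2\<^sup>n)\<close>.
\<close>

abbreviation swap_pts :: "'a \<Rightarrow> 'a \<Rightarrow> 'a \<Rightarrow> 'a"
  where "swap_pts \<equiv> Transposition.transpose"

section \<open>Influences of sums of juntas\<close>

text \<open>Closure under pointwise addition stands in for a Fourier expansion of degree
  \<open>e\<close>: each summand depends on at most \<open>e\<close> of the involutions. Values are
  vectors, so that whole states can be treated at once.\<close>

inductive junta_sum :: "'b set \<Rightarrow> ('i \<Rightarrow> 'b \<Rightarrow> 'b) \<Rightarrow> 'i set \<Rightarrow> nat \<Rightarrow> ('b \<Rightarrow> 'v::real_inner) \<Rightarrow> bool"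
  for \<Omega> \<tau> \<Lambda> e
where
  junta: "\<lbrakk>finite J; card J \<le> e; \<And>i \<omega>. i \<in> \<Lambda> - J \<Longrightarrow> \<omega> \<in> \<Omega> \<Longrightarrow> g (\<tau> i \<omega>) = g \<omega>\<rbrakk> \<Longrightarrow> junta_sum \<Omega> \<tau> \<Lambda> e g"
| add: "\<lbrakk>junta_sum \<Omega> \<tau> \<Lambda> e f; junta_sum \<Omega> \<tau> \<Lambda> e g; \<And>\<omega>. \<omega> \<in> \<Omega> \<Longrightarrow> h \<omega> = f \<omega> + g \<omega>\<rbrakk> \<Longrightarrow> junta_sum \<Omega> \<tau> \<Lambda> e h"

lemma sum_involution:
  assumes "\<And>\<omega>. \<omega> \<in> \<Omega> \<Longrightarrow> t \<omega> \<in> \<Omega>" "\<And>\<omega>. \<omega> \<in> \<Omega> \<Longrightarrow> t (t \<omega>) = \<omega>"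
  shows "(\<Sum>\<omega>\<in>\<Omega>. f (t \<omega>)) = (\<Sum>\<omega>\<in>\<Omega>. f \<omega>)"
  by (rule sum.reindex_bij_witness[of _ t t]) (use assms in auto)

text \<open>This is the parallelogram law at \<open>g \<omega>\<close> and
  \<open>g (t \<omega>)\<close>, summed over \<open>\<Omega>\<close>; the involution makes both
  points contribute the same total.\<close>

lemma sum_norm_sq_split:
  fixes g :: "'b \<Rightarrow> 'v::real_inner"
  assumes "\<And>\<omega>. \<omega> \<in> \<Omega> \<Longrightarrow> t \<omega> \<in> \<Omega>" "\<And>\<omega>. \<omega> \<in> \<Omega> \<Longrightarrow> t (t \<omega>) = \<omega>"
  shows "(\<Sum>\<omega>\<in>\<Omega>. (norm (g \<omega>))\<^sup>2) =
    (\<Sum>\<omega>\<in>\<Omega>. (norm ((1/2) *\<^sub>R (g \<omega> + g (t \<omega>))))\<^sup>2) + (\<Sum>\<omega>\<in>\<Omega>. (norm ((1/2) *\<^sub>R (g \<omega> - g (t \<omega>))))\<^sup>2)"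
proof -
  have "(norm ((1/2) *\<^sub>R (x + y)))\<^sup>2 + (norm ((1/2) *\<^sub>R (x - y)))\<^sup>2 = ((norm x)\<^sup>2 + (norm y)\<^sup>2) / 2" for x y :: 'v
    by (simp add: power_mult_distrib power2_norm_eq_inner inner_add_left inner_add_right inner_diff_left inner_diff_right inner_commute field_simps)
  then have "(\<Sum>\<omega>\<in>\<Omega>. (norm ((1/2) *\<^sub>R (g \<omega> + g (t \<omega>))))\<^sup>2) + (\<Sum>\<omega>\<in>\<Omega>. (norm ((1/2) *\<^sub>R (g \<omega> - g (t \<omega>))))\<^sup>2)
      = ((\<Sum>\<omega>\<in>\<Omega>. (norm (g \<omega>))\<^sup>2) + (\<Sum>\<omega>\<in>\<Omega>. (norm (g (t \<omega>)))\<^sup>2)) / 2"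
    by (simp only: sum.distrib[symmetric] sum_divide_distrib)
  then show ?thesis
    using sum_involution[of \<Omega> t "\<lambda>\<omega>. (norm (g \<omega>))\<^sup>2"] assms by simp
qed

text \<open>Since \<open>\<tau> p\<close> commutes with the other involutions, composing a junta
  with \<open>\<tau> p\<close> keeps its invariances, so no junta gains a variable.\<close>

lemma junta_sum_even_part:
  assumes "junta_sum \<Omega> \<tau> (insert p \<Lambda>) e g"
    and t: "\<And>\<omega>. \<omega> \<in> \<Omega> \<Longrightarrow> \<tau> p \<omega> \<in> \<Omega>"
    and c: "\<And>i \<omega>. i \<in> \<Lambda> \<Longrightarrow> \<omega> \<in> \<Omega> \<Longrightarrow> \<tau> p (\<tau> i \<omega>) = \<tau> i (\<tau> p \<omega>)"
  shows "junta_sum \<Omega> \<tau> \<Lambda> e (\<lambda>\<omega>. (1/2) *\<^sub>R (g \<omega> + g (\<tau> p \<omega>)))"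
  using assms(1)
proof induction
  case (junta J g)
  then show ?case
    by (intro junta_sum.junta[of J]) (auto simp: t c)
next
  case (add f g h)
  show ?case
    by (rule junta_sum.add[OF add.IH]) (simp add: add.hyps t algebra_simps)
qed

lemma junta_sum_odd_part:
  assumes "junta_sum \<Omega> \<tau> (insert p \<Lambda>) e g"
    and t: "\<And>\<omega>. \<omega> \<in> \<Omega> \<Longrightarrow> \<tau> p \<omega> \<in> \<Omega>"
    and c: "\<And>i \<omega>. i \<in> \<Lambda> \<Longrightarrow> \<omega> \<in> \<Omega> \<Longrightarrow> \<tau> p (\<tau> i \<omega>) = \<tau> i (\<tau> p \<omega>)"
    and ti: "\<And>i \<omega>. i \<in> \<Lambda> \<Longrightarrow> \<omega> \<in> \<Omega> \<Longrightarrow> \<tau> i \<omega> \<in> \<Omega>"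
    and p: "p \<notin> \<Lambda>"
  shows "if e = 0 then \<forall>\<omega>\<in>\<Omega>. g (\<tau> p \<omega>) = g \<omega>
    else junta_sum \<Omega> \<tau> \<Lambda> (e - 1) (\<lambda>\<omega>. (1/2) *\<^sub>R (g \<omega> - g (\<tau> p \<omega>)))"
  using assms(1)
proof induction
  case (junta J g)
  show ?case
  proof (cases "p \<in> J")
    case True
    then have "card J > 0"
      using junta(1) by (auto simp: card_gt_0_iff)
    then have "e \<noteq> 0" "card (J - {p}) \<le> e - 1"
      using junta(1,2) True by (auto simp: card_Diff_singleton)
    moreover have "junta_sum \<Omega> \<tau> \<Lambda> (e - 1) (\<lambda>\<omega>. (1/2) *\<^sub>R (g \<omega> - g (\<tau> p \<omega>)))"
    proof (rule junta_sum.junta[of "J - {p}"])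
      fix i \<omega> assume i: "i \<in> \<Lambda> - (J - {p})" "\<omega> \<in> \<Omega>"
      show "(1/2) *\<^sub>R (g (\<tau> i \<omega>) - g (\<tau> p (\<tau> i \<omega>))) = (1/2) *\<^sub>R (g \<omega> - g (\<tau> p \<omega>))"
        using i junta(3) p True by (auto simp: c t)
    qed (use calculation junta in auto)
    ultimately show ?thesis by simp
  next
    case False
    then have "g (\<tau> p \<omega>) = g \<omega>" if "\<omega> \<in> \<Omega>" for \<omega>
      using junta(3)[of p \<omega>] that by auto
    then show ?thesis
      by (auto intro!: junta_sum.junta[of "{}"] simp: ti)
  qed
next
  case (add f g h)
  show ?case
  proof (cases "e = 0")
    case True then show ?thesis using add t by auto
  next
    case False
    then have "junta_sum \<Omega> \<tau> \<Lambda> (e - 1) (\<lambda>\<omega>. (1/2) *\<^sub>R (f \<omega> - f (\<tau> p \<omega>)))" 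
     "junta_sum \<Omega> \<tau> \<Lambda> (e - 1) (\<lambda>\<omega>. (1/2) *\<^sub>R (g \<omega> - g (\<tau> p \<omega>)))" using add.IH by auto
    from junta_sum.add[OF this] have "junta_sum \<Omega> \<tau> \<Lambda> (e - 1) (\<lambda>\<omega>. (1/2) *\<^sub>R (h \<omega> - h (\<tau> p \<omega>)))"
      by (simp add: add.hyps t algebra_simps)
    with False show ?thesis by simp
  qed
qed

text \<open>
  Splitting \<open>g\<close> into its even and odd part under one of the involutions is orthogonal and is
  respected by all the others. The odd part only involves juntas that depend on this involution,
  which lowers the degree by one and pays for the influence of the removed involution.
\<close>

lemma influence_le:
  fixes g :: "'b \<Rightarrow> 'v::real_inner"
  assumes "finite \<Lambda>"
    and "\<And>i \<omega>. i \<in> \<Lambda> \<Longrightarrow> \<omega> \<in> \<Omega> \<Longrightarrow> \<tau> i \<omega> \<in> \<Omega>"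
    and "\<And>i \<omega>. i \<in> \<Lambda> \<Longrightarrow> \<omega> \<in> \<Omega> \<Longrightarrow> \<tau> i (\<tau> i \<omega>) = \<omega>"
    and "\<And>i j \<omega>. i \<in> \<Lambda> \<Longrightarrow> j \<in> \<Lambda> \<Longrightarrow> \<omega> \<in> \<Omega> \<Longrightarrow> \<tau> i (\<tau> j \<omega>) = \<tau> j (\<tau> i \<omega>)"
    and "junta_sum \<Omega> \<tau> \<Lambda> e g"
  shows "(\<Sum>i\<in>\<Lambda>. \<Sum>\<omega>\<in>\<Omega>. (norm (g \<omega> - g (\<tau> i \<omega>)))\<^sup>2) \<le> 4 * real e * (\<Sum>\<omega>\<in>\<Omega>. (norm (g \<omega>))\<^sup>2)"
  using assms
proof (induction \<Lambda> arbitrary: e g)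
  case empty
  then show ?case by (simp add: sum_nonneg)
next
  case (insert p \<Lambda>)
  define a where "a = (\<lambda>\<omega>. (1/2) *\<^sub>R (g \<omega> + g (\<tau> p \<omega>)))"
  define b where "b = (\<lambda>\<omega>. (1/2) *\<^sub>R (g \<omega> - g (\<tau> p \<omega>)))"
  let ?N = "\<lambda>h::'b \<Rightarrow> 'v. \<Sum>\<omega>\<in>\<Omega>. (norm (h \<omega>))\<^sup>2"
  have t: "\<tau> p \<omega> \<in> \<Omega>" "\<tau> p (\<tau> p \<omega>) = \<omega>" if "\<omega> \<in> \<Omega>" for \<omega>
    using insert.prems that by auto
  have c: "\<tau> p (\<tau> i \<omega>) = \<tau> i (\<tau> p \<omega>)" and ti: "\<tau> i \<omega> \<in> \<Omega>" if "i \<in> \<Lambda>" "\<omega> \<in> \<Omega>" for i \<omega>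
    using insert.prems that by auto
  have split: "?N g = ?N a + ?N b"
    unfolding a_def b_def by (rule sum_norm_sq_split) (use t in auto)
  have a_diff: "a \<omega> - a (\<tau> i \<omega>) = (1/2) *\<^sub>R ((g \<omega> - g (\<tau> i \<omega>)) + (g (\<tau> p \<omega>) - g (\<tau> i (\<tau> p \<omega>))))"
    and b_diff: "b \<omega> - b (\<tau> i \<omega>) = (1/2) *\<^sub>R ((g \<omega> - g (\<tau> i \<omega>)) - (g (\<tau> p \<omega>) - g (\<tau> i (\<tau> p \<omega>))))"
    if "i \<in> \<Lambda>" "\<omega> \<in> \<Omega>" for i \<omega>
    using c[OF that] by (simp_all add: a_def b_def algebra_simps)
  have split_i: "?N (\<lambda>\<omega>. g \<omega> - g (\<tau> i \<omega>)) = ?N (\<lambda>\<omega>. a \<omega> - a (\<tau> i \<omega>)) + ?N (\<lambda>\<omega>. b \<omega> - b (\<tau> i \<omega>))"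
    if i: "i \<in> \<Lambda>" for i
    using sum_norm_sq_split[of \<Omega> "\<tau> p" "\<lambda>\<omega>. g \<omega> - g (\<tau> i \<omega>)", OF t]
    by (simp only: a_diff[OF i] b_diff[OF i] cong: sum.cong)
  \<comment> \<open>\<open>b\<close> is half of this difference, hence the factor 4.\<close>
  have p: "?N (\<lambda>\<omega>. g \<omega> - g (\<tau> p \<omega>)) = 4 * ?N b"
    by (simp add: b_def power_mult_distrib sum_distrib_left power2_eq_square)
  have IH: "(\<Sum>i\<in>\<Lambda>. ?N (\<lambda>\<omega>. h \<omega> - h (\<tau> i \<omega>))) \<le> 4 * real e' * ?N h" if "junta_sum \<Omega> \<tau> \<Lambda> e' h" for h e'
    by (rule insert.IH[OF _ _ _ that]) (use insert.prems in auto)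
  have A: "(\<Sum>i\<in>\<Lambda>. ?N (\<lambda>\<omega>. a \<omega> - a (\<tau> i \<omega>))) \<le> 4 * real e * ?N a"
    by (rule IH) (unfold a_def, rule junta_sum_even_part[OF insert.prems(4)], use t c in auto)
  have B: "(\<Sum>i\<in>\<Lambda>. ?N (\<lambda>\<omega>. b \<omega> - b (\<tau> i \<omega>))) + 4 * ?N b \<le> 4 * real e * ?N b"
  proof (cases "e = 0")
    case True
    then have "b \<omega> = 0" if "\<omega> \<in> \<Omega>" for \<omega>
      using junta_sum_odd_part[OF insert.prems(4) t(1) c ti insert.hyps(2)] that by (simp add: b_def)
    then show ?thesis using True by (simp add: ti)
  next
    case False
    then have "junta_sum \<Omega> \<tau> \<Lambda> (e - 1) b"
      using junta_sum_odd_part[OF insert.prems(4) t(1) c ti insert.hyps(2)] by (simp add: b_def)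
    from IH[OF this] False show ?thesis
      by (simp add: of_nat_diff algebra_simps)
  qed
  have "(\<Sum>i\<in>insert p \<Lambda>. ?N (\<lambda>\<omega>. g \<omega> - g (\<tau> i \<omega>))) =
     4 * ?N b + ((\<Sum>i\<in>\<Lambda>. ?N (\<lambda>\<omega>. a \<omega> - a (\<tau> i \<omega>))) + (\<Sum>i\<in>\<Lambda>. ?N (\<lambda>\<omega>. b \<omega> - b (\<tau> i \<omega>))))"
    using insert.hyps by (simp add: p split_i sum.distrib)
  also have "\<dots> \<le> 4 * real e * ?N g"
    using A B unfolding split by (simp add: algebra_simps)
  finally show ?case .
qed

section \<open>Functions of bounded degree on permutations\<close>

text \<open>
  The state of an algorithm after \<open>d\<close> queries to \<open>P\<close>, in either direction, is of this form.
\<close>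

inductive perm_degree :: "nat \<Rightarrow> (('n::finite bits \<Rightarrow> 'n bits) \<Rightarrow> 'v::real_inner) \<Rightarrow> bool" for d where
  monomial: "\<lbrakk>card M \<le> d; \<And>P. P \<in> perms \<Longrightarrow> g P = (if \<forall>(a, b)\<in>M. P a = b then c else 0)\<rbrakk> \<Longrightarrow> perm_degree d g"
| add: "\<lbrakk>perm_degree d f; perm_degree d g; \<And>P. P \<in> perms \<Longrightarrow> h P = f P + g P\<rbrakk> \<Longrightarrow> perm_degree d h"

lemma perm_degree_const: "perm_degree d (\<lambda>P. c)"
  by (rule perm_degree.monomial[of "{}" _ _ c]) auto

lemma perm_degree_sum:
  "finite I \<Longrightarrow> (\<And>i. i \<in> I \<Longrightarrow> perm_degree d (g i)) \<Longrightarrow> perm_degree d (\<lambda>P. \<Sum>i\<in>I. g i P)"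
  by (induction rule: finite_induct) (auto intro: perm_degree_const perm_degree.add)

lemma perm_degree_cong:
  assumes "perm_degree d f" "\<And>P. P \<in> perms \<Longrightarrow> g P = f P"
  shows "perm_degree d g"
  by (rule perm_degree.add[OF assms(1) perm_degree_const[of d 0]]) (use assms(2) in auto)

lemma perm_degree_additive:
  fixes B :: "'v::real_inner \<Rightarrow> 'u::real_inner"
  assumes "perm_degree d g" "\<And>x y. B (x + y) = B x + B y"
  shows "perm_degree d (\<lambda>P. B (g P))"
proof -
  have B0: "B 0 = 0" using assms(2)[of 0 0] by simp
  show ?thesis using assms(1)
  proof induction
    case (monomial M g c)
    then show ?case by (intro perm_degree.monomial[of M _ _ "B c"]) (auto simp: B0)
  next
    case (add f g h)
    show ?case by (rule perm_degree.add[OF add.IH]) (simp add: add.hyps assms(2))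
  qed
qed

text \<open>An indicator of one value adds at most one pair to each monomial.\<close>

lemma perm_degree_query:
  assumes "perm_degree d g"
  shows "perm_degree (Suc d) (\<lambda>P. if P a = b then g P else 0)"
  using assms
proof induction
  case (monomial M g c)
  have "card (insert (a, b) M) \<le> Suc d"
    using monomial(1) by (simp add: card_insert_if)
  then show ?case using monomial
    by (intro perm_degree.monomial[of "insert (a, b) M" _ _ c]) auto
next
  case (add f g h)
  show ?case by (rule perm_degree.add[OF add.IH]) (simp add: add.hyps)
qed

lemma inv_in_perms: "P \<in> perms \<Longrightarrow> inv P \<in> perms"
  by (simp add: perms_def bij_imp_bij_inv)

lemma perms_inv_eq_iff: "P \<in> perms \<Longrightarrow> inv P y = x \<longleftrightarrow> P x = y"
  unfolding perms_def by (metis bij_inv_eq_iff mem_Collect_eq)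

text \<open>\<open>inv P a = b\<close> is the same condition as \<open>P b = a\<close>, so each
  monomial has its pairs transposed.\<close>

lemma perm_degree_inv:
  assumes "perm_degree d g"
  shows "perm_degree d (\<lambda>P. g (inv P))"
  using assms
proof induction
  case (monomial M g c)
  have "card (prod.swap ` M) \<le> d"
    using monomial(1) card_image_le[of M prod.swap] by simp
  then show ?case
    by (intro perm_degree.monomial[of "prod.swap ` M" _ _ c])
      (auto simp: monomial inv_in_perms perms_inv_eq_iff split: prod.splits)
next
  case (add f g h)
  show ?case by (rule perm_degree.add[OF add.IH]) (simp add: add.hyps inv_in_perms)
qed

text \<open>A monomial of degree zero imposes no condition. Such states occur before the first
  quantum query, where moving the switch over a classical query is exact.\<close>

lemma perm_degree_zero_const:
  assumes "perm_degree 0 g"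
  shows "\<exists>c. \<forall>P\<in>perms. g P = c"
  using assms
proof induction
  case (monomial M g c)
  then have "M = {}" by (simp add: finite)
  then show ?case using monomial by auto
next
  case (add f g h)
  then show ?case by auto
qed

section \<open>Exchanging two values of a permutation\<close>

lemma swap_comp_bij:
  assumes "bij f"
  shows "swap_pts (f a) (f b) \<circ> f = f \<circ> swap_pts a b"
  using assms by (auto simp: fun_eq_iff Transposition.transpose_def bij_def inj_eq)

lemma comp_swap_in_perms: "P \<in> perms \<Longrightarrow> P \<circ> swap_pts a b \<in> perms"
  unfolding perms_def by (simp add: bij_comp)

lemma swap_comp_in_perms: "P \<in> perms \<Longrightarrow> swap_pts a b \<circ> P \<in> perms"
  unfolding perms_def by (simp add: bij_comp)

text \<open>The pairs \<open>{s, m s}\<close> are orbits of \<open>m\<close>, so two of them are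
  equal or disjoint.\<close>

lemma swap_involution_commute:
  assumes m: "\<And>s. m (m s) = s"
  shows "swap_pts s (m s) \<circ> swap_pts t (m t) = swap_pts t (m t) \<circ> swap_pts s (m s)"
proof -
  have "m s = m t \<longleftrightarrow> s = t" "m s = t \<longleftrightarrow> s = m t" by (metis m)+
  then show ?thesis
    by (cases "s = t"; cases "s = m t") (auto simp: fun_eq_iff Transposition.transpose_def m)
qed

text \<open>A monomial with at most \<open>d\<close> pairs changes only under exchanges whose orbit
  meets its points, which are at most \<open>2 * d\<close> indices. With \<open>influence_le\<close>
  this gives the factor \<open>4 * (2 * d)\<close>.\<close>

lemma sum_resampled_le:
  fixes g :: "('n::finite bits \<Rightarrow> 'n bits) \<Rightarrow> 'v::real_inner"
  assumes g: "perm_degree d g" and m: "\<And>s. m (m s) = s"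
  shows "(\<Sum>s\<in>UNIV. \<Sum>P\<in>perms. (norm (g P - g (P \<circ> swap_pts s (m s))))\<^sup>2) \<le> 8 * real d * (\<Sum>P\<in>perms. (norm (g P))\<^sup>2)"
proof -
  let ?\<tau> = "\<lambda>s P. P \<circ> swap_pts s (m s)"
  have "junta_sum perms ?\<tau> UNIV (2 * d) g"
    using g
  proof induction
    case (monomial M g c)
    define J where "J = fst ` M \<union> m ` fst ` M"
    have "card J \<le> card (fst ` M) + card (m ` fst ` M)"
      unfolding J_def by (rule card_Un_le)
    also have "\<dots> \<le> 2 * d"
      using monomial(1) card_image_le[of M fst] card_image_le[of "fst ` M" m] by simp
    finally have J: "card J \<le> 2 * d" .
    show ?case
    proof (rule junta_sum.junta[OF _ J])
      fix s P assume s: "s \<in> UNIV - J" and P: "P \<in> (perms :: ('n bits \<Rightarrow> 'n bits) set)"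
      have "a \<noteq> s \<and> a \<noteq> m s" if "(a, b) \<in> M" for a b
      proof -
        have "a \<in> J" "m a \<in> J" using that by (force simp: J_def)+
        then show ?thesis using s m by auto
      qed
      then have "(\<forall>(a, b)\<in>M. ?\<tau> s P a = b) \<longleftrightarrow> (\<forall>(a, b)\<in>M. P a = b)"
        by (fastforce simp: Transposition.transpose_def)
      then show "g (?\<tau> s P) = g P"
        using monomial(2) P comp_swap_in_perms[OF P] by simp
    qed simp
  next
    case (add f g h)
    show ?case
      by (rule junta_sum.add[OF add.IH]) (rule add.hyps)
  qed
  moreover have "?\<tau> s (?\<tau> t P) = ?\<tau> t (?\<tau> s P)" for s t and P :: "'n bits \<Rightarrow> 'n bits"
    using swap_involution_commute[of m t s] m by (simp only: comp_assoc)
  moreover have "?\<tau> s (?\<tau> s P) = P" for s and P :: "'n bits \<Rightarrow> 'n bits"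
    by (simp add: fun_eq_iff)
  ultimately have "(\<Sum>s\<in>UNIV. \<Sum>P\<in>perms. (norm (g P - g (?\<tau> s P)))\<^sup>2) \<le> 4 * real (2 * d) * (\<Sum>P\<in>perms. (norm (g P))\<^sup>2)"
    by (intro influence_le comp_swap_in_perms) simp_all
  then show ?thesis by simp
qed

section \<open>Reprogramming\<close>

text \<open>The value at \<open>s\<close> is exchanged with \<open>t\<close>, not overwritten, so
  bijections stay bijections. The head of the list is processed last.\<close>

fun reprogram :: "('a \<times> 'a) list \<Rightarrow> ('a \<Rightarrow> 'a) \<Rightarrow> 'a \<Rightarrow> 'a" where
  "reprogram [] P = P"
| "reprogram ((s, t) # L) P = swap_pts (reprogram L P s) t \<circ> reprogram L P"

lemma bij_reprogram [simp]:
  assumes "bij P"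
  shows "bij (reprogram L P)"
proof (induction L)
  case (Cons st L)
  then have "bij (swap_pts (reprogram L P (fst st)) (snd st) \<circ> reprogram L P)"
    by (rule bij_comp) (rule bij_transpose)
  then show ?case
    by (cases st) (simp add: comp_def)
qed (simp add: assms)

text \<open>A later exchange at \<open>s'\<close> moves only the values \<open>t'\<close> and
  \<open>reprogram L P s'\<close>. By distinctness and injectivity neither is the value
  \<open>t\<close> already set at \<open>s\<close>.\<close>

lemma reprogram_consistent:
  assumes "bij P" "distinct (map fst L)" "distinct (map snd L)" "(s, t) \<in> set L"
  shows "reprogram L P s = t"
  using assms
proof (induction L)
  case (Cons st L)
  obtain s' t' where st: "st = (s', t')" by force
  show ?case
  proof (cases "(s, t) = (s', t')")
    case False
    then have mem: "(s, t) \<in> set L" using Cons.prems st by auto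
    then have "s \<in> fst ` set L" "t \<in> snd ` set L" by force+
    then have "s \<noteq> s'" "t \<noteq> t'" using Cons.prems st by auto
    moreover have "reprogram L P s = t" using Cons mem by simp
    moreover have "reprogram L P s' \<noteq> reprogram L P s"
      using bij_reprogram[OF assms(1), of L] \<open>s \<noteq> s'\<close> by (simp add: bij_def inj_eq)
    ultimately show ?thesis using st by (simp add: Transposition.transpose_def)
  qed (simp add: st)
qed simp

lemma reprogram_unchanged:
  assumes "bij P" "z \<notin> fst ` set L" "P z \<notin> snd ` set L"
  shows "reprogram L P z = P z"
  using assms
proof (induction L)
  case (Cons st L)
  obtain s t where st: "st = (s, t)" by force
  have "reprogram L P z = P z" using Cons by simp
  moreover have "reprogram L P z \<noteq> reprogram L P s"
    using bij_reprogram[OF assms(1), of L] Cons.prems(2) st by (simp add: bij_def inj_eq)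
  ultimately show ?case using Cons.prems st by (simp add: Transposition.transpose_def)
qed simp

text \<open>A permutation \<open>f\<close> that fixes the prescribed values can be pulled through
  each exchange: conjugation by \<open>f\<close> carries the exchange of \<open>a\<close> and
  \<open>t\<close> to that of \<open>f a\<close> and \<open>t\<close>.\<close>

lemma reprogram_comp:
  assumes "bij f" "\<And>t. t \<in> snd ` set L \<Longrightarrow> f t = t"
  shows "reprogram L (f \<circ> P) = f \<circ> reprogram L P"
  using assms(2)
proof (induction L)
  case (Cons st L)
  obtain s t where st: "st = (s, t)" by force
  have "reprogram L (f \<circ> P) = f \<circ> reprogram L P"
    by (rule Cons.IH) (use Cons.prems in simp)
  moreover have "swap_pts (f a) t \<circ> f = f \<circ> swap_pts a t" for a
    using swap_comp_bij[OF assms(1), of a t] Cons.prems st by simp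
  ultimately show ?case
    unfolding st reprogram.simps comp_apply by (metis comp_assoc)
qed simp

text \<open>Setting the value \<open>t\<close> at \<open>s\<close> by an exchange is, seen from the
  inverse, setting the value \<open>s\<close> at \<open>t\<close>. This reduces inverse queries to
  forward ones.\<close>

lemma inv_reprogram:
  assumes "bij P"
  shows "inv (reprogram L P) = reprogram (map prod.swap L) (inv P)"
proof (induction L)
  case (Cons st L)
  obtain s t where st: "st = (s, t)" by force
  let ?R = "reprogram L P"
  have R: "bij ?R" using assms by simp
  have "inv (swap_pts (?R s) t \<circ> ?R) = inv ?R \<circ> swap_pts (?R s) t"
    using R by (subst o_inv_distrib) auto
  also have "\<dots> = swap_pts (inv ?R t) s \<circ> inv ?R"
    using R by (auto simp: fun_eq_iff Transposition.transpose_def bij_inv_eq_iff bij_def inj_eq surj_f_inv_f)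
  finally show ?case
    by (simp only: st Cons.IH[symmetric] reprogram.simps list.map swap_simp)
qed simp

declare reprogram.simps(2) [simp del]

section \<open>Resampling a value of a permutation\<close>

definition total_weight :: "(('n::finite bits \<Rightarrow> 'n bits) \<Rightarrow> 'v::real_inner) \<Rightarrow> real"
  where "total_weight \<psi> = (\<Sum>P\<in>perms. (norm (\<psi> P))\<^sup>2)"

definition swap_influence :: "(('n::finite bits \<Rightarrow> 'n bits) \<Rightarrow> 'v::real_inner) \<Rightarrow> 'n bits \<Rightarrow> real"
  where "swap_influence \<psi> s = (\<Sum>P\<in>perms. \<Sum>b\<in>UNIV. (norm (\<psi> P - \<psi> (P \<circ> swap_pts s b)))\<^sup>2)"

lemma total_weight_nonneg: "0 \<le> total_weight \<psi>"
  by (simp add: total_weight_def sum_nonneg)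

lemma xor_bits_cancel [simp]: "(x \<oplus> y) \<oplus> y = x" "x \<oplus> (x \<oplus> y) = y"
  by (auto simp: xor_bits_def fun_eq_iff)

lemma bij_xor_bits: "bij (\<lambda>x. x \<oplus> k)" "bij (\<lambda>x. k \<oplus> x)"
  by (rule involuntory_imp_bij, simp)+

lemma xor_bits_left_cancel [simp]: "(x \<oplus> k = y \<oplus> k) = (x = y)" "(k \<oplus> x = k \<oplus> y) = (x = y)"
  by (auto simp: xor_bits_def fun_eq_iff)

text \<open>With \<open>b = s \<oplus> c\<close> and \<open>c\<close> fixed, the partner of
  \<open>s\<close> is given by an involution, so \<open>sum_resampled_le\<close> applies; the number
  of choices of \<open>c\<close> gives the factor in front.\<close>

lemma sum_swap_influence_le:
  fixes \<psi> :: "('n::finite bits \<Rightarrow> 'n bits) \<Rightarrow> 'v::real_inner"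
  assumes "perm_degree d \<psi>"
  shows "(\<Sum>s\<in>UNIV. swap_influence \<psi> s) \<le> real CARD('n bits) * (8 * real d * total_weight \<psi>)"
proof -
  let ?f = "\<lambda>s b P. (norm (\<psi> P - \<psi> (P \<circ> swap_pts s b)))\<^sup>2"
  have "swap_influence \<psi> s = (\<Sum>c\<in>UNIV. \<Sum>P\<in>perms. ?f s (s \<oplus> c) P)" for s
    unfolding swap_influence_def
    by (subst sum.swap, rule sum.reindex_bij_betw[symmetric, OF bij_xor_bits(2)])
  then have "(\<Sum>s\<in>UNIV. swap_influence \<psi> s) = (\<Sum>c\<in>UNIV. \<Sum>s\<in>UNIV. \<Sum>P\<in>perms. ?f s (s \<oplus> c) P)"
    by (simp, subst sum.swap) simp
  also have "\<dots> \<le> (\<Sum>c\<in>(UNIV :: 'n bits set). 8 * real d * total_weight \<psi>)"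
    by (intro sum_mono, unfold total_weight_def, rule sum_resampled_le[OF assms]) simp
  finally show ?thesis by simp
qed

lemma sum_perms_comp_swap:
  "(\<Sum>P\<in>perms. f (P \<circ> swap_pts a b)) = (\<Sum>P\<in>(perms :: ('n::finite bits \<Rightarrow> 'n bits) set). f P)"
  by (rule sum_involution[of perms "\<lambda>P. P \<circ> swap_pts a b"]) (simp_all add: comp_swap_in_perms comp_assoc)

text \<open>
  A state of low degree cannot put much weight on the event \<open>P s = t\<close>, since the state is almost
  unchanged if the value at \<open>s\<close> is exchanged with the value at a random point.
\<close>

lemma weight_of_value_le:
  fixes \<psi> :: "('n::finite bits \<Rightarrow> 'n bits) \<Rightarrow> 'v::real_inner"
  shows "(\<Sum>P\<in>perms. if P s = t then (norm (\<psi> P))\<^sup>2 else 0)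
    \<le> 2 / real CARD('n bits) * (swap_influence \<psi> s + total_weight \<psi>)"
proof -
  let ?w = "\<lambda>P. (norm (\<psi> P))\<^sup>2" and ?N = "real CARD('n bits)"
  have le: "(norm u)\<^sup>2 \<le> 2 * (norm (u - v))\<^sup>2 + 2 * (norm v)\<^sup>2" for u v :: 'v
  proof -
    have "norm u \<le> norm (u - v) + norm v" by (metis diff_add_cancel norm_triangle_ineq)
    then have "(norm u)\<^sup>2 \<le> (norm (u - v) + norm v)\<^sup>2" by (simp add: power_mono)
    also have "\<dots> \<le> 2 * (norm (u - v))\<^sup>2 + 2 * (norm v)\<^sup>2"
      using sum_squares_bound[of "norm (u - v)" "norm v"] by (simp add: power2_sum)
    finally show ?thesis .
  qed
  have "?N * (\<Sum>P\<in>perms. if P s = t then ?w P else 0) = (\<Sum>b\<in>(UNIV::'n bits set). \<Sum>P\<in>perms. if P s = t then ?w P else 0)"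
    by simp
  also have "\<dots> \<le> (\<Sum>b\<in>UNIV. \<Sum>P\<in>perms. 2 * (norm (\<psi> P - \<psi> (P \<circ> swap_pts s b)))\<^sup>2
      + 2 * (if P s = t then ?w (P \<circ> swap_pts s b) else 0))"
    by (intro sum_mono) (auto intro: le)
  also have "\<dots> = 2 * swap_influence \<psi> s + 2 * (\<Sum>b\<in>UNIV. \<Sum>P\<in>perms. if P s = t then ?w (P \<circ> swap_pts s b) else 0)"
    unfolding swap_influence_def sum.swap[of _ UNIV perms] by (simp add: sum.distrib sum_distrib_left)
  \<comment> \<open>Reindexing by the exchange itself turns the event \<open>P s = t\<close> into
    \<open>P b = t\<close>, which for each \<open>P\<close> holds for exactly one
    \<open>b\<close>.\<close>
  also have "(\<Sum>b\<in>UNIV. \<Sum>P\<in>perms. if P s = t then ?w (P \<circ> swap_pts s b) else 0)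
     = (\<Sum>b\<in>UNIV. \<Sum>P\<in>perms. if P b = t then ?w P else 0)"
    using sum_perms_comp_swap[of "\<lambda>P. if P b = t then ?w P else 0" s b for b] by simp
  also have "\<dots> = (\<Sum>P\<in>perms. \<Sum>b\<in>UNIV. if P b = t then ?w P else 0)"
    by (rule sum.swap)
  also have "\<dots> = (\<Sum>P\<in>perms. ?w P)"
  proof (rule sum.cong)
    fix P :: "'n bits \<Rightarrow> 'n bits" assume "P \<in> perms"
    then have "P b = t \<longleftrightarrow> b = inv P t" for b using perms_inv_eq_iff by metis
    then show "(\<Sum>b\<in>UNIV. if P b = t then ?w P else 0) = ?w P" by simp
  qed simp
  finally show ?thesis
    by (simp add: total_weight_def field_simps)
qed

lemma reprogram_notin:
  assumes "bij P" "distinct (map fst L)" "distinct (map snd L)" "s \<notin> fst ` set L"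
  shows "reprogram L P s \<notin> snd ` set L"
proof
  assume "reprogram L P s \<in> snd ` set L"
  then obtain s' where s': "(s', reprogram L P s) \<in> set L" by force
  from reprogram_consistent[OF assms(1-3) this] have "s' = s"
    using bij_reprogram[OF assms(1), of L] by (simp add: bij_def inj_eq)
  then show False using s' assms(4) by force
qed

text \<open>
  Reindexing by the involution that maps \<open>(P, v)\<close> to the permutation with the values \<open>v\<close> and
  \<open>reprogram L P s\<close> exchanged, together with the old value \<open>reprogram L P s\<close>. It turns the
  resampling of the oracle into a change of the state that was computed from the oracle.
\<close>

lemma sum_resample_swap:
  fixes f :: "('n::finite bits \<Rightarrow> 'n bits) \<Rightarrow> ('n bits \<Rightarrow> 'n bits) \<Rightarrow> real"
  assumes L: "distinct (map fst L)" "distinct (map snd L)" "s \<notin> fst ` set L"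
  shows "(\<Sum>P\<in>perms. \<Sum>v\<in>- snd ` set L. f (reprogram ((s, v) # L) P) P)
    = (\<Sum>P\<in>perms. \<Sum>v\<in>- snd ` set L. f (reprogram L P) (swap_pts (reprogram L P s) v \<circ> P))"
proof -
  let ?h = "\<lambda>(P, v). (swap_pts (reprogram L P s) v \<circ> P, reprogram L P s)"
  let ?X = "(perms :: ('n bits \<Rightarrow> 'n bits) set) \<times> (- snd ` set L)"
  have notin: "reprogram L P s \<notin> snd ` set L" if "P \<in> perms" for P
    by (rule reprogram_notin[OF _ L]) (use that in \<open>simp add: perms_def\<close>)
  have step: "reprogram L (swap_pts (reprogram L P s) v \<circ> P) = swap_pts (reprogram L P s) v \<circ> reprogram L P"
    if "P \<in> perms" "v \<notin> snd ` set L" for P v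
  \<comment> \<open>Both exchanged values lie outside the prescribed ones, so the exchange fixes
    those and passes through \<open>reprogram L\<close>.\<close>
  proof (rule reprogram_comp[OF bij_transpose])
    fix t assume "t \<in> snd ` set L"
    then have "t \<noteq> reprogram L P s" "t \<noteq> v" using notin[OF that(1)] that(2) by metis+
    then show "swap_pts (reprogram L P s) v t = t" by (rule transpose_apply_other)
  qed
  have new_value: "reprogram L (swap_pts (reprogram L P s) v \<circ> P) s = v"
    if "P \<in> perms" "v \<notin> snd ` set L" for P v
    using step[OF that] by (simp add: transpose_commute)
  have undo: "swap_pts v a \<circ> (swap_pts a v \<circ> f) = f" for v a :: "'n bits" and f :: "'n bits \<Rightarrow> 'n bits"
    by (simp only: transpose_commute[of v a] comp_assoc[symmetric] transpose_comp_involutory id_comp)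
  have h: "?h x \<in> ?X" "?h (?h x) = x" if "x \<in> ?X" for x
  proof -
    obtain P v where x: "x = (P, v)" by force
    with that have Pv: "P \<in> perms" "v \<notin> snd ` set L" by auto
    show "?h x \<in> ?X" using Pv notin by (simp add: x swap_comp_in_perms)
    show "?h (?h x) = x" by (simp only: x prod.case new_value[OF Pv] undo)
  qed
  have "(\<Sum>P\<in>perms. \<Sum>v\<in>- snd ` set L. f (reprogram ((s, v) # L) P) P) =
     (\<Sum>(P, v)\<in>?X. f (swap_pts (reprogram L P s) v \<circ> reprogram L P) P)"
    by (simp add: sum.cartesian_product reprogram.simps(2))
  also have "\<dots> = (\<Sum>x\<in>?X. (case ?h x of (P, v) \<Rightarrow> f (swap_pts (reprogram L P s) v \<circ> reprogram L P) P))"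
    by (rule sum_involution[of ?X ?h, symmetric]) (use h in auto)
  also have "\<dots> = (\<Sum>(P, v)\<in>?X. f (reprogram L P) (swap_pts (reprogram L P s) v \<circ> P))"
  proof (rule sum.cong)
    fix x assume x: "x \<in> ?X"
    obtain P v where Pv: "x = (P, v)" by force
    with x have "P \<in> perms" "v \<notin> snd ` set L" by auto
    note facts = step[OF this] new_value[OF this]
    have "swap_pts (reprogram L (swap_pts (reprogram L P s) v \<circ> P) s) (reprogram L P s)
       \<circ> reprogram L (swap_pts (reprogram L P s) v \<circ> P) = reprogram L P"
      by (simp only: facts(2)) (simp only: facts(1) undo)
    then show "(case ?h x of (P, v) \<Rightarrow> f (swap_pts (reprogram L P s) v \<circ> reprogram L P) P) =
        (case x of (P, v) \<Rightarrow> f (reprogram L P) (swap_pts (reprogram L P s) v \<circ> P))"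
      by (simp add: Pv)
  qed simp
  also have "\<dots> = (\<Sum>P\<in>perms. \<Sum>v\<in>- snd ` set L. f (reprogram L P) (swap_pts (reprogram L P s) v \<circ> P))"
    by (simp add: sum.cartesian_product)
  finally show ?thesis .
qed

lemma card_unused:
  fixes L :: "('a::finite \<times> 'a) list"
  assumes "distinct (map fst L)" "distinct (map snd L)" "s \<notin> fst ` set L"
  shows "length L < CARD('a)" "real (card (- snd ` set L)) = real CARD('a) - real (length L)"
proof -
  have "card (fst ` set L) < CARD('a)"
    using assms(3) by (intro psubset_card_mono) auto
  moreover have "card (fst ` set L) = length L"
    using assms(1) by (metis distinct_card length_map list.set_map)
  ultimately show "length L < CARD('a)" by simp
  have "card (snd ` set L) = length L"
    using assms(2) by (metis distinct_card length_map list.set_map)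
  then show "real (card (- snd ` set L)) = real CARD('a) - real (length L)"
    using card_mono[of UNIV "snd ` set L"]
    by (simp add: Compl_eq_Diff_UNIV card_Diff_subset of_nat_diff)
qed

text \<open>
  If \<open>P s\<close> is not among the prescribed values, the exchange of values amounts to \<open>P \<circ> swap_pts s b\<close>,
  and \<open>swap_influence\<close> bounds its effect. The other event is bounded by \<open>weight_of_value_le\<close>.
  The parameter \<open>x\<close> balances the arithmetic-geometric mean inequality, which replaces
  Cauchy-Schwarz here because it is linear and can be averaged over the keys.
\<close>

lemma resample_fixed:
  fixes \<psi> :: "('n::finite bits \<Rightarrow> 'n bits) \<Rightarrow> 'v::real_inner"
    and G :: "('n bits \<Rightarrow> 'n bits) \<Rightarrow> 'v \<Rightarrow> real"
  defines "N \<equiv> real CARD('n bits)"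
  assumes G0: "\<And>Q u. Q \<in> perms \<Longrightarrow> 0 \<le> G Q u \<and> G Q u \<le> (norm u)\<^sup>2"
    and G_diff: "\<And>Q u v. Q \<in> perms \<Longrightarrow> \<bar>G Q u - G Q v\<bar> \<le> norm (u - v) * (norm u + norm v)"
    and L: "distinct (map fst L)" "distinct (map snd L)" "s \<notin> fst ` set L"
    and x: "x > 0"
  shows "\<bar>(\<Sum>P\<in>perms. G (reprogram L P) (\<psi> P))
      - (\<Sum>P\<in>perms. \<Sum>v\<in>- snd ` set L. G (reprogram ((s, v) # L) P) (\<psi> P)) / (N - length L)\<bar>
    \<le> swap_influence \<psi> s / ((N - length L) * x) + x * total_weight \<psi>
      + 2 * real (length L) * (2 / N * (swap_influence \<psi> s + total_weight \<psi>))"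
proof -
  let ?T = "snd ` set L"
  define V where "V = - ?T"
  define M where "M = N - length L"
  let ?R = "reprogram L"
  define flip where "flip = (\<lambda>P v. swap_pts (?R P s) v \<circ> P)"
  let ?w = "\<lambda>P. (norm (\<psi> P))\<^sup>2"
  let ?bad = "\<lambda>P. P s \<in> ?T"
  have finV: "finite V" by (rule finite)
  have cardT: "card ?T = length L"
    using L(2) by (metis distinct_card length_map list.set_map)
  have M0: "M > 0" and cardV: "real (card V) = M"
    using card_unused[OF L] by (simp_all add: M_def N_def V_def)
  have bijR: "?R P \<in> perms" if "P \<in> perms" for P using that by (simp add: perms_def)
  have RV: "?R P s \<in> V" if "P \<in> perms" for P
    using reprogram_notin[OF _ L] that by (simp add: V_def perms_def)
  have flip_perms: "flip P v \<in> perms" if "P \<in> perms" for P v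
    unfolding flip_def by (rule swap_comp_in_perms[OF that])
  have flip_bad: "?bad (flip P v) \<longleftrightarrow> ?bad P" if "P \<in> perms" "v \<in> V" for P v
    using RV[OF that(1)] that(2) by (auto simp: flip_def V_def Transposition.transpose_def)
  have resampled: "(\<Sum>P\<in>perms. \<Sum>v\<in>V. f (reprogram ((s, v) # L) P) P)
    = (\<Sum>P\<in>perms. \<Sum>v\<in>V. f (?R P) (flip P v))" for f :: "('n bits \<Rightarrow> 'n bits) \<Rightarrow> _ \<Rightarrow> real"
    unfolding V_def flip_def by (rule sum_resample_swap[OF L])
  \<comment> \<open>Taking a summand independent of the reprogrammed oracle in
    \<open>resampled\<close> shows that a random \<open>flip\<close> preserves sums over
    \<open>P\<close>.\<close>
  have sum_flip: "(\<Sum>P\<in>perms. \<Sum>v\<in>V. f (flip P v)) = M * (\<Sum>P\<in>perms. f P)" for f :: "('n bits \<Rightarrow> 'n bits) \<Rightarrow> real"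
    using resampled[of "\<lambda>_. f"] by (simp add: cardV sum_distrib_left)
  have good: "(\<Sum>v\<in>V. (norm (\<psi> P - \<psi> (flip P v)))\<^sup>2) \<le> (\<Sum>b\<in>UNIV. (norm (\<psi> P - \<psi> (P \<circ> swap_pts s b)))\<^sup>2)"
    if P: "P \<in> perms" and "\<not> ?bad P" "s \<notin> fst ` set L" for P
  proof -
    have bP: "bij P" using P by (simp add: perms_def)
    have "?R P s = P s"
      using that bP by (intro reprogram_unchanged) auto
    \<comment> \<open>Here the exchange of the values \<open>P s\<close> and \<open>v\<close> is the
      exchange of the arguments \<open>s\<close> and \<open>inv P v\<close>.\<close>
    then have "flip P v = P \<circ> swap_pts s (inv P v)" for v
      using swap_comp_bij[OF bP, of s "inv P v"] bP by (simp only: flip_def bij_is_surj surj_f_inv_f)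
    then have "(\<Sum>v\<in>V. (norm (\<psi> P - \<psi> (flip P v)))\<^sup>2) \<le> (\<Sum>v\<in>UNIV. (norm (\<psi> P - \<psi> (P \<circ> swap_pts s (inv P v))))\<^sup>2)"
      by (simp add: sum_mono2)
    also have "\<dots> = (\<Sum>b\<in>UNIV. (norm (\<psi> P - \<psi> (P \<circ> swap_pts s b)))\<^sup>2)"
      by (rule sum.reindex_bij_betw[OF bij_imp_bij_inv[OF bP]])
    finally show ?thesis .
  qed
  \<comment> \<open>On the bad event both terms are bounded by the weights alone; otherwise
    \<open>G_diff\<close> is split by the inequality with parameter \<open>x\<close>. The event is
    preserved by \<open>flip\<close>, so its weight can be counted at both ends.\<close>
  have pointwise: "\<bar>G (?R P) (\<psi> P) - G (?R P) (\<psi> (flip P v))\<bar> \<le>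
     (if ?bad P then 0 else (norm (\<psi> P - \<psi> (flip P v)))\<^sup>2 / x) + x / 2 * (?w P + ?w (flip P v))
     + ((if ?bad P then ?w P else 0) + (if ?bad (flip P v) then ?w (flip P v) else 0))"
    if P: "P \<in> perms" and v: "v \<in> V" for P v
  proof (cases "?bad P")
    case True
    have "\<bar>G (?R P) (\<psi> P) - G (?R P) (\<psi> (flip P v))\<bar> \<le> ?w P + ?w (flip P v)"
      using G0[OF bijR[OF P], of "\<psi> P"] G0[OF bijR[OF P], of "\<psi> (flip P v)"] by linarith
    moreover have "0 \<le> x / 2 * (?w P + ?w (flip P v))" using x by simp
    ultimately show ?thesis using True flip_bad[OF P v] by simp
  next
    case False
    define a where "a = norm (\<psi> P - \<psi> (flip P v))"
    define b where "b = norm (\<psi> P)"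
    define c where "c = norm (\<psi> (flip P v))"
    have "a * (b + c) \<le> a\<^sup>2 / x + x / 4 * (b + c)\<^sup>2"
    proof -
      have "0 \<le> (a - x / 2 * (b + c))\<^sup>2 / x" using x by simp
      also have "\<dots> = a\<^sup>2 / x + x / 4 * (b + c)\<^sup>2 - a * (b + c)"
        using x by (simp add: power2_eq_square field_simps)
      finally show ?thesis by simp
    qed
    also have "x / 4 * (b + c)\<^sup>2 \<le> x / 2 * (b\<^sup>2 + c\<^sup>2)"
    proof -
      have "(b + c)\<^sup>2 \<le> 2 * (b\<^sup>2 + c\<^sup>2)"
        using sum_squares_bound[of b c] by (simp add: power2_sum)
      then have "x / 4 * (b + c)\<^sup>2 \<le> x / 4 * (2 * (b\<^sup>2 + c\<^sup>2))" using x by (intro mult_left_mono) auto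
      then show ?thesis by (simp add: algebra_simps)
    qed
    finally have "a * (b + c) \<le> a\<^sup>2 / x + x / 2 * (b\<^sup>2 + c\<^sup>2)" by simp
    then show ?thesis
      using G_diff[OF bijR[OF P], of "\<psi> P" "\<psi> (flip P v)"] False flip_bad[OF P v]
      by (simp add: a_def b_def c_def)
  qed
  let ?A = "\<Sum>P\<in>perms. G (?R P) (\<psi> P)"
  let ?B = "\<Sum>P\<in>perms. \<Sum>v\<in>V. G (reprogram ((s, v) # L) P) (\<psi> P)"
  let ?S = "total_weight \<psi>" and ?I = "swap_influence \<psi> s"
  define bad_weight where "bad_weight = (\<Sum>P\<in>perms. if ?bad P then ?w P else 0)"
  have "\<bar>M * ?A - ?B\<bar> = \<bar>\<Sum>P\<in>perms. \<Sum>v\<in>V. G (?R P) (\<psi> P) - G (?R P) (\<psi> (flip P v))\<bar>"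
    using resampled[of "\<lambda>Q P. G Q (\<psi> P)"] by (simp add: sum_subtractf cardV sum_distrib_left)
  also have "\<dots> \<le> (\<Sum>P\<in>perms. \<Sum>v\<in>V. \<bar>G (?R P) (\<psi> P) - G (?R P) (\<psi> (flip P v))\<bar>)"
    by (intro order_trans[OF sum_abs] sum_mono) simp
  also have "\<dots> \<le> (\<Sum>P\<in>perms. \<Sum>v\<in>V. (if ?bad P then 0 else (norm (\<psi> P - \<psi> (flip P v)))\<^sup>2 / x) + x / 2 * (?w P + ?w (flip P v))
     + ((if ?bad P then ?w P else 0) + (if ?bad (flip P v) then ?w (flip P v) else 0)))"
    by (intro sum_mono pointwise)
  also have "\<dots> = (\<Sum>P\<in>perms. \<Sum>v\<in>V. if ?bad P then 0 else (norm (\<psi> P - \<psi> (flip P v)))\<^sup>2 / x)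
     + x / 2 * ((\<Sum>P\<in>perms. \<Sum>v\<in>V. ?w P) + (\<Sum>P\<in>perms. \<Sum>v\<in>V. ?w (flip P v)))
     + ((\<Sum>P\<in>perms. \<Sum>v\<in>V. if ?bad P then ?w P else 0) + (\<Sum>P\<in>perms. \<Sum>v\<in>V. if ?bad (flip P v) then ?w (flip P v) else 0))"
    by (simp only: sum.distrib sum_distrib_left[symmetric])
  also have "\<dots> = (\<Sum>P\<in>perms. \<Sum>v\<in>V. if ?bad P then 0 else (norm (\<psi> P - \<psi> (flip P v)))\<^sup>2 / x)
     + x * (M * ?S) + 2 * (M * bad_weight)"
    unfolding sum_flip[of ?w] sum_flip[of "\<lambda>P. if ?bad P then ?w P else 0"]
    by (simp add: cardV sum_distrib_left[symmetric] total_weight_def bad_weight_def)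
  also have "(\<Sum>P\<in>perms. \<Sum>v\<in>V. if ?bad P then 0 else (norm (\<psi> P - \<psi> (flip P v)))\<^sup>2 / x) \<le> ?I / x"
    unfolding swap_influence_def sum_divide_distrib
  proof (intro sum_mono)
    fix P :: "'n bits \<Rightarrow> 'n bits" assume P: "P \<in> perms"
    show "(\<Sum>v\<in>V. if ?bad P then 0 else (norm (\<psi> P - \<psi> (flip P v)))\<^sup>2 / x)
      \<le> (\<Sum>b\<in>UNIV. (norm (\<psi> P - \<psi> (P \<circ> swap_pts s b)))\<^sup>2 / x)"
      using good[OF P] L(3) x
      by (cases "?bad P") (simp_all add: sum_nonneg sum_divide_distrib[symmetric] divide_right_mono)
  qed
  also have "bad_weight \<le> (\<Sum>P\<in>perms. \<Sum>t\<in>?T. if P s = t then ?w P else 0)"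
    unfolding bad_weight_def by (intro sum_mono) (auto intro!: sum_nonneg simp: finite)
  also have "\<dots> = (\<Sum>t\<in>?T. \<Sum>P\<in>perms. if P s = t then ?w P else 0)"
    by (rule sum.swap)
  also have "\<dots> \<le> (\<Sum>t\<in>?T. 2 / N * (?I + ?S))"
    unfolding N_def by (intro sum_mono weight_of_value_le)
  also have "\<dots> = real (length L) * (2 / N * (?I + ?S))"
    by (simp only: sum_constant cardT)
  finally have main: "\<bar>M * ?A - ?B\<bar> \<le> ?I / x + x * (M * ?S) + 2 * (M * (real (length L) * (2 / N * (?I + ?S))))"
    using M0 by simp
  have "\<bar>a - b / M\<bar> = \<bar>M * a - b\<bar> / M" for a b
  proof -
    have "a - b / M = (M * a - b) / M" using M0 by (simp add: field_simps)
    then show ?thesis using M0 by (simp add: abs_divide)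
  qed
  then have "\<bar>?A - ?B / M\<bar> = \<bar>M * ?A - ?B\<bar> / M" .
  also have "\<dots> \<le> (?I / x + x * (M * ?S) + 2 * (M * (real (length L) * (2 / N * (?I + ?S))))) / M"
    using main M0 by (intro divide_right_mono) auto
  also have "\<dots> = ?I / (M * x) + x * ?S + 2 * real (length L) * (2 / N * (?I + ?S))"
    using M0 by (simp add: add_divide_distrib mult.commute)
  finally show ?thesis unfolding M_def V_def .
qed

text \<open>The first term is twice the balancing parameter chosen in
  \<open>resample_average\<close>, the second comes from the event that \<open>P s\<close> is a
  prescribed value. For \<open>d = 0\<close> both vanish.\<close>

definition resample_error :: "'n::finite itself \<Rightarrow> nat \<Rightarrow> nat \<Rightarrow> real"
  where "resample_error _ d j = 2 * sqrt (80 * real d / (9 * real CARD('n bits))) + 36 * real j * real d / real CARD('n bits)"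

text \<open>\<open>resample_fixed\<close> holds for each key separately. Averaging over keys with
  \<open>s k\<close> uniform replaces the single influence by the mean influence, which is at most
  \<open>8 * d\<close> times the total weight.\<close>

lemma resample_average:
  fixes \<psi> :: "('n::finite bits \<Rightarrow> 'n bits) \<Rightarrow> 'v::real_inner"
    and G :: "'k::finite \<Rightarrow> ('n bits \<Rightarrow> 'n bits) \<Rightarrow> 'v \<Rightarrow> real"
  defines "N \<equiv> real CARD('n bits)"
  assumes G0: "\<And>k Q u. Q \<in> perms \<Longrightarrow> 0 \<le> G k Q u \<and> G k Q u \<le> (norm u)\<^sup>2"
    and G_diff: "\<And>k Q u v. Q \<in> perms \<Longrightarrow> \<bar>G k Q u - G k Q v\<bar> \<le> norm (u - v) * (norm u + norm v)"
    and L: "\<And>k. distinct (map fst (L k))" "\<And>k. distinct (map snd (L k))" "\<And>k. s k \<notin> fst ` set (L k)"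
    and len: "\<And>k. length (L k) = j"
    and p0: "\<And>k. 0 \<le> p k"
    and uniform: "\<And>h. (\<Sum>k\<in>UNIV. p k * h (s k)) = (\<Sum>a\<in>UNIV. h a) / N"
    and deg: "perm_degree d \<psi>"
    and small: "d = 0 \<or> 10 * j \<le> CARD('n bits)"
  shows "\<bar>(\<Sum>k\<in>UNIV. p k * (\<Sum>P\<in>perms. G k (reprogram (L k) P) (\<psi> P)))
      - (\<Sum>k\<in>UNIV. p k * ((\<Sum>P\<in>perms. \<Sum>v\<in>- snd ` set (L k). G k (reprogram ((s k, v) # L k) P) (\<psi> P)) / (N - j)))\<bar>
    \<le> resample_error TYPE('n) d j * total_weight \<psi>"
proof -
  let ?A = "\<lambda>k. \<Sum>P\<in>perms. G k (reprogram (L k) P) (\<psi> P)"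
  let ?B = "\<lambda>k. (\<Sum>P\<in>perms. \<Sum>v\<in>- snd ` set (L k). G k (reprogram ((s k, v) # L k) P) (\<psi> P)) / (N - j)"
  let ?S = "total_weight \<psi>"
  have eq: "\<bar>(\<Sum>k\<in>UNIV. p k * ?A k) - (\<Sum>k\<in>UNIV. p k * ?B k)\<bar> \<le> (\<Sum>k\<in>UNIV. p k * \<bar>?A k - ?B k\<bar>)"
  proof -
    have "(\<Sum>k\<in>UNIV. p k * ?A k) - (\<Sum>k\<in>UNIV. p k * ?B k) = (\<Sum>k\<in>UNIV. p k * (?A k - ?B k))"
      by (simp only: sum_subtractf[symmetric] right_diff_distrib)
    then show ?thesis
      using sum_abs[of "\<lambda>k. p k * (?A k - ?B k)" UNIV] p0 by (simp add: abs_mult)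
  qed
  show ?thesis
  proof (cases "d = 0")
    \<comment> \<open>A constant state is unaffected by the exchange of values, so both averages
      agree exactly for every \<open>k\<close>, and \<open>j\<close> may be arbitrary.\<close>
    case True
    obtain c where c: "\<And>P. P \<in> perms \<Longrightarrow> \<psi> P = c"
      using perm_degree_zero_const deg True by blast
    have "?A k = ?B k" for k
    proof -
      have "(\<Sum>P\<in>perms. \<Sum>v\<in>- snd ` set (L k). G k (reprogram ((s k, v) # L k) P) (\<psi> P))
          = (\<Sum>P\<in>perms. \<Sum>v\<in>- snd ` set (L k). G k (reprogram ((s k, v) # L k) P) c)"
        by (simp add: c)
      also have "\<dots> = (N - j) * (\<Sum>P\<in>perms. G k (reprogram (L k) P) c)"
        using sum_resample_swap[OF L, of "\<lambda>Q _. G k Q c" k] card_unused(2)[OF L, of k]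
        by (simp add: len N_def sum_distrib_left)
      finally show ?thesis
        using card_unused(1)[OF L, of k] by (simp add: c len N_def)
    qed
    then show ?thesis by (simp add: resample_error_def True)
  next
    case False
    \<comment> \<open>This \<open>x\<close> solves \<open>8 * d / (9 / 10 * N * x) = x\<close>,
      which balances the two main terms when \<open>N - j\<close> is at least
      \<open>9 / 10 * N\<close>.\<close>
    define x where "x = sqrt (80 * real d / (9 * N))"
    have N0: "N > 0" by (simp add: N_def)
    have x0: "x > 0" and x2: "x\<^sup>2 = 80 * real d / (9 * N)"
      using False N0 by (simp_all add: x_def)
    have S0: "?S \<ge> 0" by (rule total_weight_nonneg)
    have M: "N - j \<ge> 9 / 10 * N" using small False by (simp add: N_def)
    then have M0: "N - j > 0" using N0 by linarith
    let ?I = "\<lambda>k. swap_influence \<psi> (s k)"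
    have sum_p: "(\<Sum>k\<in>UNIV. p k) = 1"
      using uniform[of "\<lambda>_. 1"] N0 by (simp add: N_def)
    have sum_I: "(\<Sum>k\<in>UNIV. p k * ?I k) \<le> 8 * real d * ?S"
    proof -
      have "(\<Sum>k\<in>UNIV. p k * ?I k) \<le> N * (8 * real d * ?S) / N"
        unfolding uniform N_def by (intro divide_right_mono sum_swap_influence_le[OF deg]) simp
      then show ?thesis using N0 by simp
    qed
    have "\<bar>(\<Sum>k\<in>UNIV. p k * ?A k) - (\<Sum>k\<in>UNIV. p k * ?B k)\<bar>
       \<le> (\<Sum>k\<in>UNIV. p k * (?I k / ((N - j) * x) + x * ?S + 2 * real j * (2 / N * (?I k + ?S))))"
      using resample_fixed[OF G0 G_diff L x0] p0
      by (intro order_trans[OF eq] sum_mono mult_left_mono) (simp_all add: len N_def)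
    also have "\<dots> = (\<Sum>k\<in>UNIV. p k * ?I k * (1 / ((N - j) * x) + 4 * real j / N) + p k * (x * ?S + 4 * real j / N * ?S))"
      by (rule sum.cong) (simp_all add: algebra_simps add_divide_distrib)
    also have "\<dots> = (\<Sum>k\<in>UNIV. p k * ?I k) * (1 / ((N - j) * x) + 4 * real j / N) + (x * ?S + 4 * real j / N * ?S)"
      by (simp add: sum.distrib sum_distrib_right[symmetric] sum_p)
    also have "\<dots> \<le> 8 * real d * ?S * (1 / ((N - j) * x) + 4 * real j / N) + (x * ?S + 4 * real j / N * ?S)"
      using sum_I x0 M0 N0 by (intro add_right_mono mult_right_mono) auto
    also have "\<dots> = (8 * real d / ((N - j) * x)) * ?S + x * ?S + 4 * real j * (8 * real d + 1) / N * ?S"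
      by (simp add: algebra_simps add_divide_distrib)
    also have "8 * real d / ((N - j) * x) \<le> x"
    proof -
      have "8 * real d = x\<^sup>2 * (9 / 10 * N)" using N0 by (simp add: x2)
      also have "\<dots> \<le> x\<^sup>2 * (N - j)" using M by (intro mult_left_mono) auto
      finally show ?thesis using x0 M0 by (simp add: divide_le_eq power2_eq_square mult_ac)
    qed
    \<comment> \<open>As \<open>d \<ge> 1\<close>, the factor \<open>8 * d + 1\<close> is at most
      \<open>9 * d\<close>, whence the constant 36.\<close>
    also have "4 * real j * (8 * real d + 1) / N \<le> 36 * real j * real d / N"
    proof -
      have "8 * real d + 1 \<le> 9 * real d" using False by simp
      then have "4 * real j * (8 * real d + 1) \<le> 4 * real j * (9 * real d)" by (intro mult_left_mono) auto
      then show ?thesis using N0 by (simp add: divide_right_mono)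
    qed
    finally have "\<bar>(\<Sum>k\<in>UNIV. p k * ?A k) - (\<Sum>k\<in>UNIV. p k * ?B k)\<bar> \<le> x * ?S + x * ?S + 36 * real j * real d / N * ?S"
      using S0 by (simp add: mult_right_mono)
    then show ?thesis
      by (simp add: resample_error_def x_def N_def algebra_simps)
  qed
qed

lemma sum_perms_inv:
  "(\<Sum>P\<in>perms. f (inv P)) = (\<Sum>P\<in>(perms :: ('n::finite bits \<Rightarrow> 'n bits) set). f P)"
  by (rule sum_involution[of perms inv]) (simp_all add: inv_in_perms, simp add: perms_def inv_inv_eq)

text \<open>Passing from \<open>P\<close> to \<open>inv P\<close> exchanges prescribed points with
  prescribed values and keeps degree and weight, so this is \<open>resample_average\<close> for the
  inverse permutation.\<close>

lemma resample_average_inverse: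
  fixes \<psi> :: "('n::finite bits \<Rightarrow> 'n bits) \<Rightarrow> 'v::real_inner"
    and G :: "'k::finite \<Rightarrow> ('n bits \<Rightarrow> 'n bits) \<Rightarrow> 'v \<Rightarrow> real"
  defines "N \<equiv> real CARD('n bits)"
  assumes G0: "\<And>k Q u. Q \<in> perms \<Longrightarrow> 0 \<le> G k Q u \<and> G k Q u \<le> (norm u)\<^sup>2"
    and G_diff: "\<And>k Q u v. Q \<in> perms \<Longrightarrow> \<bar>G k Q u - G k Q v\<bar> \<le> norm (u - v) * (norm u + norm v)"
    and L: "\<And>k. distinct (map fst (L k))" "\<And>k. distinct (map snd (L k))" "\<And>k. t k \<notin> snd ` set (L k)"
    and len: "\<And>k. length (L k) = j"
    and p0: "\<And>k. 0 \<le> p k"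
    and uniform: "\<And>h. (\<Sum>k\<in>UNIV. p k * h (t k)) = (\<Sum>a\<in>UNIV. h a) / N"
    and deg: "perm_degree d \<psi>"
    and small: "d = 0 \<or> 10 * j \<le> CARD('n bits)"
  shows "\<bar>(\<Sum>k\<in>UNIV. p k * (\<Sum>P\<in>perms. G k (reprogram (L k) P) (\<psi> P)))
      - (\<Sum>k\<in>UNIV. p k * ((\<Sum>P\<in>perms. \<Sum>v\<in>- fst ` set (L k). G k (reprogram ((v, t k) # L k) P) (\<psi> P)) / (N - j)))\<bar>
    \<le> resample_error TYPE('n) d j * total_weight \<psi>"
proof -
  let ?L = "\<lambda>k. map prod.swap (L k)"
  have fst_L: "map fst (?L k) = map snd (L k)" and snd_L: "map snd (?L k) = map fst (L k)" for k
    by (simp_all add: comp_def)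
  have imgs: "fst ` set (?L k) = snd ` set (L k)" "snd ` set (?L k) = fst ` set (L k)" for k
    by (simp_all add: image_image)
  have inv_swap: "inv (reprogram (map prod.swap M) P) = reprogram M (inv P)"
    if "P \<in> perms" for M and P :: "'n bits \<Rightarrow> 'n bits"
    using that by (simp add: inv_reprogram perms_def comp_def)
  have main: "\<bar>(\<Sum>k\<in>UNIV. p k * (\<Sum>P\<in>perms. G k (inv (reprogram (?L k) P)) (\<psi> (inv P))))
      - (\<Sum>k\<in>UNIV. p k * ((\<Sum>P\<in>perms. \<Sum>v\<in>- snd ` set (?L k). G k (inv (reprogram ((t k, v) # ?L k) P)) (\<psi> (inv P))) / (real CARD('n bits) - j)))\<bar>
    \<le> resample_error TYPE('n) d j * total_weight (\<lambda>P. \<psi> (inv P))"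
    by (rule resample_average[where G = "\<lambda>k Q. G k (inv Q)"])
      (use assms in \<open>simp_all only: fst_L snd_L imgs perm_degree_inv inv_in_perms length_map simp_thms\<close>)
  have weight: "total_weight (\<lambda>P. \<psi> (inv P)) = total_weight \<psi>"
    unfolding total_weight_def by (rule sum_perms_inv[of "\<lambda>P. (norm (\<psi> P))\<^sup>2"])
  have first: "(\<Sum>P\<in>perms. G k (inv (reprogram (?L k) P)) (\<psi> (inv P))) = (\<Sum>P\<in>perms. G k (reprogram (L k) P) (\<psi> P))" for k
    using sum_perms_inv[of "\<lambda>P. G k (reprogram (L k) P) (\<psi> P)"] by (simp only: inv_swap cong: sum.cong)
  have second: "(\<Sum>P\<in>perms. \<Sum>v\<in>- snd ` set (?L k). G k (inv (reprogram ((t k, v) # ?L k) P)) (\<psi> (inv P)))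
     = (\<Sum>P\<in>perms. \<Sum>v\<in>- fst ` set (L k). G k (reprogram ((v, t k) # L k) P) (\<psi> P))" for k
    using sum_perms_inv[of "\<lambda>P. \<Sum>v\<in>- fst ` set (L k). G k (reprogram ((v, t k) # L k) P) (\<psi> P)"]
      inv_swap[of _ "(v, t k) # L k" for v, unfolded list.map swap_simp]
    by (simp only: imgs cong: sum.cong)
  show ?thesis using main unfolding weight first second N_def .
qed

section \<open>Acceptance weights\<close>

text \<open>
  The states are not normalised after measurements, so that they are linear images of the
  initial state and keep their degree as functions of the oracle.
\<close>

primrec accept :: "('n, 'w::finite) qalg \<Rightarrow> ('n bits \<Rightarrow> 'n bits) \<Rightarrow> ('n bits \<Rightarrow> 'n bits) \<Rightarrow> 'w state \<Rightarrow> real" where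
  "accept (Output b) O1 O2 \<psi> = (if b then (norm \<psi>)\<^sup>2 else 0)"
| "accept (Measure m M K) O1 O2 \<psi> = (\<Sum>i<m. accept (K i) O1 O2 (M i *v \<psi>))"
| "accept (ClassicalQuery d x K) O1 O2 \<psi> = accept (K (directed d O1 x)) O1 O2 \<psi>"
| "accept (QuantumQuery d rx ry A) O1 O2 \<psi> = accept A O1 O2 (query_unitary (directed d O2) rx ry *v \<psi>)"

lemma matrix_vector_scaleR: "(A :: 'w::finite operator) *v (c *\<^sub>R \<psi>) = c *\<^sub>R (A *v \<psi>)"
  by (simp add: vec_eq_iff matrix_vector_mult_def scaleR_sum_right)

lemma accept_scaleR: "accept A O1 O2 (c *\<^sub>R \<psi>) = c\<^sup>2 * accept A O1 O2 \<psi>"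
  by (induction A arbitrary: \<psi>) (simp_all add: power_mult_distrib matrix_vector_scaleR sum_distrib_left)

lemma accept_bounds:
  "well_formed A \<Longrightarrow> 0 \<le> accept A O1 O2 \<psi> \<and> accept A O1 O2 \<psi> \<le> (norm \<psi>)\<^sup>2"
proof (induction A arbitrary: \<psi>)
  case (Measure m M K)
  then have "0 \<le> accept (K i) O1 O2 (M i *v \<psi>) \<and> accept (K i) O1 O2 (M i *v \<psi>) \<le> (norm (M i *v \<psi>))\<^sup>2" if "i < m" for i
    using that by auto
  then have "0 \<le> (\<Sum>i<m. accept (K i) O1 O2 (M i *v \<psi>))"
    "(\<Sum>i<m. accept (K i) O1 O2 (M i *v \<psi>)) \<le> (\<Sum>i<m. (norm (M i *v \<psi>))\<^sup>2)"
    by (auto intro!: sum_nonneg sum_mono)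
  then show ?case
    using complete_measurement_norm[of m M \<psi>] Measure.prems by simp
next
  case (QuantumQuery d rx ry A)
  then show ?case
    using QuantumQuery.IH[of "query_unitary (directed d O2) rx ry *v \<psi>"] by (simp add: norm_query_unitary)
qed auto

text \<open>This reflects the quadratic dependence on the state. For a measurement, the branch
  bounds are combined by Cauchy-Schwarz, and completeness makes the squared norms of the branches
  add up, so the constant stays 1.\<close>

lemma accept_diff:
  "well_formed A \<Longrightarrow> \<bar>accept A O1 O2 \<psi> - accept A O1 O2 \<phi>\<bar> \<le> norm (\<psi> - \<phi>) * (norm \<psi> + norm \<phi>)"
proof (induction A arbitrary: \<psi> \<phi>)
  case (Output b)
  have "\<bar>(norm \<psi>)\<^sup>2 - (norm \<phi>)\<^sup>2\<bar> = \<bar>norm \<psi> - norm \<phi>\<bar> * (norm \<psi> + norm \<phi>)"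
    by (simp add: power2_eq_square square_diff_square_factored abs_mult)
  also have "\<dots> \<le> norm (\<psi> - \<phi>) * (norm \<psi> + norm \<phi>)"
    by (intro mult_right_mono norm_triangle_ineq3) simp
  finally show ?case by simp
next
  case (Measure m M K)
  let ?n = "\<lambda>\<phi>. L2_set (\<lambda>i. norm (M i *v \<phi>)) {..<m}"
  have n: "?n \<phi> = norm \<phi>" for \<phi>
    using complete_measurement_norm[of m M \<phi>] Measure.prems by (simp add: L2_set_def)
  have "\<bar>(\<Sum>i<m. accept (K i) O1 O2 (M i *v \<psi>)) - (\<Sum>i<m. accept (K i) O1 O2 (M i *v \<phi>))\<bar>
    \<le> (\<Sum>i<m. \<bar>accept (K i) O1 O2 (M i *v \<psi>) - accept (K i) O1 O2 (M i *v \<phi>)\<bar>)"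
    by (simp only: sum_subtractf[symmetric] sum_abs)
  also have "\<dots> \<le> (\<Sum>i<m. norm (M i *v (\<psi> - \<phi>)) * (norm (M i *v \<psi>) + norm (M i *v \<phi>)))"
    using Measure by (intro sum_mono) (auto simp: matrix_vector_mult_diff_distrib)
  also have "\<dots> = (\<Sum>i<m. \<bar>norm (M i *v (\<psi> - \<phi>))\<bar> * \<bar>norm (M i *v \<psi>)\<bar>) + (\<Sum>i<m. \<bar>norm (M i *v (\<psi> - \<phi>))\<bar> * \<bar>norm (M i *v \<phi>)\<bar>)"
    by (simp add: distrib_left sum.distrib)
  also have "\<dots> \<le> ?n (\<psi> - \<phi>) * ?n \<psi> + ?n (\<psi> - \<phi>) * ?n \<phi>"
    by (intro add_mono L2_set_mult_ineq)
  finally show ?case by (simp add: n distrib_left)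
next
  case (QuantumQuery d rx ry A)
  let ?U = "query_unitary (directed d O2) rx ry"
  have "\<bar>accept A O1 O2 (?U *v \<psi>) - accept A O1 O2 (?U *v \<phi>)\<bar>
     \<le> norm (?U *v (\<psi> - \<phi>)) * (norm (?U *v \<psi>) + norm (?U *v \<phi>))"
    using QuantumQuery by (auto simp: matrix_vector_mult_diff_distrib)
  then show ?case using QuantumQuery.prems by (simp add: norm_query_unitary)
qed auto

text \<open>The probability of an outcome is the squared factor removed by normalisation, so
  \<open>accept_scaleR\<close> absorbs it.\<close>

lemma pmf_run_from:
  "well_formed A \<Longrightarrow> norm \<psi> = 1 \<Longrightarrow> pmf (run_from A O1 O2 \<psi>) True = accept A O1 O2 \<psi>"
proof (induction A arbitrary: \<psi>)
  case (Measure m M K)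
  let ?q = "measurement_outcome m M \<psi>"
  have pq: "pmf ?q i = (if i < m then (norm (M i *v \<psi>))\<^sup>2 else 0)" for i
    by (rule pmf_measurement_outcome) (use Measure.prems in auto)
  have "pmf (run_from (Measure m M K) O1 O2 \<psi>) True =
     (\<integral>i. pmf (run_from (K i) O1 O2 (post_measurement (M i) \<psi>)) True \<partial>measure_pmf ?q)"
    by (simp add: pmf_bind)
  also have "\<dots> = (\<Sum>i<m. pmf ?q i * pmf (run_from (K i) O1 O2 (post_measurement (M i) \<psi>)) True)"
    by (subst integral_measure_pmf[of "{..<m}"]) (auto simp: set_pmf_eq pq split: if_splits)
  also have "\<dots> = (\<Sum>i<m. accept (K i) O1 O2 (M i *v \<psi>))"
  proof (rule sum.cong)
    fix i assume i: "i \<in> {..<m}"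
    show "pmf ?q i * pmf (run_from (K i) O1 O2 (post_measurement (M i) \<psi>)) True = accept (K i) O1 O2 (M i *v \<psi>)"
    \<comment> \<open>For an outcome of probability zero the post-measurement vector is zero, not a
      unit vector, so the induction hypothesis does not apply; both sides vanish.\<close>
    proof (cases "M i *v \<psi> = 0")
      case True
      then show ?thesis using accept_scaleR[of "K i" O1 O2 0 0] i by (simp add: pq)
    next
      case False
      then have "pmf (run_from (K i) O1 O2 (post_measurement (M i) \<psi>)) True = accept (K i) O1 O2 (post_measurement (M i) \<psi>)"
        using Measure i by (intro Measure.IH) (auto simp: norm_post_measurement)
      then show ?thesis using False i by (simp add: pq post_measurement_def accept_scaleR power_divide)
    qed
  qed simp
  finally show ?case by simp
next
  case (QuantumQuery d rx ry A)
  then show ?case by (simp add: norm_query_unitary)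
qed auto

section \<open>Action of a query on amplitudes\<close>

lemma query_unitary_apply:
  assumes "disjoint_registers rx ry"
  shows "(query_unitary f rx ry *v \<psi>) $ t = \<psi> $ query_basis f rx ry t"
proof -
  have "t = query_basis f rx ry s \<longleftrightarrow> s = query_basis f rx ry t" for s
    using query_basis_involution[OF assms] by metis
  then show ?thesis
    by (simp add: query_unitary_def matrix_vector_mult_def if_distrib[where f = "\<lambda>z. z * _"] cong: if_cong)
qed

lemma query_basis_input:
  "disjoint_registers rx ry \<Longrightarrow> query_basis f rx ry t \<circ> rx = t \<circ> rx"
  by (auto simp: query_basis_def disjoint_registers_def fun_eq_iff)

lemma query_basis_cong: "f (t \<circ> rx) = g (t \<circ> rx) \<Longrightarrow> query_basis f rx ry t = query_basis g rx ry t"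
  by (simp only: query_basis_def)

text \<open>A query is a sum over pairs \<open>(a, b)\<close> of additive maps of the state, each
  switched on by the indicator that \<open>a\<close> is answered with \<open>b\<close>; every such
  indicator raises the degree by one.\<close>

lemma perm_degree_query_unitary:
  fixes \<psi> :: "('n::finite bits \<Rightarrow> 'n bits) \<Rightarrow> 'w::finite state"
  assumes deg: "perm_degree d \<psi>" and reg: "disjoint_registers rx ry"
  shows "perm_degree (Suc d) (\<lambda>P. query_unitary (directed dir P) rx ry *v \<psi> P)"
proof -
  define B where "B = (\<lambda>(a :: 'n bits, b :: 'n bits) (\<phi> :: 'w state). (\<chi> t. if t \<circ> rx = a then \<phi> $ query_basis (\<lambda>_. b) rx ry t else 0) :: 'w state)"
  have B_add: "B ab (u + v) = B ab u + B ab v" for ab u v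
    by (cases ab) (auto simp: B_def vec_eq_iff)
  have pt: "query_unitary f rx ry *v \<phi> = (\<Sum>a\<in>UNIV. B (a, f a) \<phi>)" for f \<phi>
  proof (subst vec_eq_iff, intro allI)
    fix t
    have "(\<Sum>a\<in>UNIV. B (a, f a) \<phi>) $ t = (\<Sum>a\<in>UNIV. if a = t \<circ> rx then \<phi> $ query_basis (\<lambda>_. f a) rx ry t else 0)"
      unfolding sum_component B_def by (rule sum.cong) auto
    also have "\<dots> = \<phi> $ query_basis f rx ry t"
      by (simp add: query_basis_cong[of "\<lambda>_. f (t \<circ> rx)" t rx f ry])
    finally show "(query_unitary f rx ry *v \<phi>) $ t = (\<Sum>a\<in>UNIV. B (a, f a) \<phi>) $ t"
      by (simp add: query_unitary_apply[OF reg])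
  qed
  \<comment> \<open>An inverse query answers \<open>a\<close> with \<open>b\<close> exactly if
    \<open>P b = a\<close>, so its indicator is again one of a single value of
    \<open>P\<close>.\<close>
  define pr where "pr = (\<lambda>a b :: 'n bits. case dir of Forward \<Rightarrow> (a, b) | Inverse \<Rightarrow> (b, a))"
  have "perm_degree (Suc d) (\<lambda>P. \<Sum>a\<in>UNIV. \<Sum>b\<in>UNIV. if P (fst (pr a b)) = snd (pr a b) then B (a, b) (\<psi> P) else 0)"
    by (intro perm_degree_sum perm_degree_query perm_degree_additive[OF deg] B_add) auto
  then show ?thesis
  proof (rule perm_degree_cong)
    fix P :: "'n bits \<Rightarrow> 'n bits" assume P: "P \<in> perms"
    have "P (fst (pr a b)) = snd (pr a b) \<longleftrightarrow> b = directed dir P a" for a b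
    proof (cases dir)
      case Inverse
      then show ?thesis by (simp add: pr_def) (metis perms_inv_eq_iff[OF P])
    qed (auto simp: pr_def)
    then show "query_unitary (directed dir P) rx ry *v \<psi> P =
      (\<Sum>a\<in>UNIV. \<Sum>b\<in>UNIV. if P (fst (pr a b)) = snd (pr a b) then B (a, b) (\<psi> P) else 0)"
      by (simp add: pt)
  qed
qed

text \<open>Amplitudes can differ only where the input register holds a point of disagreement. There
  the squared difference is at most twice the sum of the squares, and each query permutes these
  basis states because it keeps the input register. This gives 2 + 2 = 4.\<close>

lemma norm_query_diff_le:
  fixes \<psi> :: "'w::finite state"
  assumes reg: "disjoint_registers rx ry"
  shows "(norm (query_unitary f rx ry *v \<psi> - query_unitary g rx ry *v \<psi>))\<^sup>2
    \<le> 4 * (\<Sum>t\<in>UNIV. if f (t \<circ> rx) \<noteq> g (t \<circ> rx) then (norm (\<psi> $ t))\<^sup>2 else 0)"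
proof -
  let ?D = "\<lambda>t. f (t \<circ> rx) \<noteq> g (t \<circ> rx)"
  have norm2: "(norm (\<phi> :: 'w state))\<^sup>2 = (\<Sum>t\<in>UNIV. (norm (\<phi> $ t))\<^sup>2)" for \<phi>
    by (simp add: norm_vec_def L2_set_def sum_nonneg)
  have re: "(\<Sum>t\<in>UNIV. if ?D t then (norm (\<psi> $ query_basis h rx ry t))\<^sup>2 else 0) = (\<Sum>t\<in>UNIV. if ?D t then (norm (\<psi> $ t))\<^sup>2 else 0)" for h
    using sum_involution[of UNIV "query_basis h rx ry" "\<lambda>t. if ?D t then (norm (\<psi> $ t))\<^sup>2 else 0"]
    by (simp add: query_basis_involution[OF reg] query_basis_input[OF reg])
  have le: "(norm (u - v))\<^sup>2 \<le> 2 * (norm u)\<^sup>2 + 2 * (norm v)\<^sup>2" for u v :: complex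
  proof -
    have "(norm (u - v))\<^sup>2 \<le> (norm u + norm v)\<^sup>2" by (simp add: power_mono norm_triangle_ineq4)
    also have "\<dots> \<le> 2 * (norm u)\<^sup>2 + 2 * (norm v)\<^sup>2"
      using sum_squares_bound[of "norm u" "norm v"] by (simp add: power2_sum)
    finally show ?thesis .
  qed
  have "(norm (query_unitary f rx ry *v \<psi> - query_unitary g rx ry *v \<psi>))\<^sup>2 =
     (\<Sum>t\<in>UNIV. (norm (\<psi> $ query_basis f rx ry t - \<psi> $ query_basis g rx ry t))\<^sup>2)"
    by (simp add: norm2 query_unitary_apply[OF reg])
  also have "\<dots> \<le> (\<Sum>t\<in>UNIV. 2 * (if ?D t then (norm (\<psi> $ query_basis f rx ry t))\<^sup>2 else 0)
       + 2 * (if ?D t then (norm (\<psi> $ query_basis g rx ry t))\<^sup>2 else 0))"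
  proof (rule sum_mono)
    fix t
    show "(norm (\<psi> $ query_basis f rx ry t - \<psi> $ query_basis g rx ry t))\<^sup>2 \<le> 2 * (if ?D t then (norm (\<psi> $ query_basis f rx ry t))\<^sup>2 else 0)
       + 2 * (if ?D t then (norm (\<psi> $ query_basis g rx ry t))\<^sup>2 else 0)"
      using le[of "\<psi> $ query_basis f rx ry t" "\<psi> $ query_basis g rx ry t"] query_basis_cong[of f t rx g ry] by auto
  qed
  also have "\<dots> = 4 * (\<Sum>t\<in>UNIV. if ?D t then (norm (\<psi> $ t))\<^sup>2 else 0)"
    by (simp only: sum.distrib sum_distrib_left[symmetric] re)
  finally show ?thesis .
qed

section \<open>Transcripts\<close>

text \<open>Every answered query is stored as a pair \<open>(x, y)\<close> with
  \<open>R x = y\<close>, so that a later query in the opposite direction is recognised as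
  repeated.\<close>

fun entry :: "direction \<Rightarrow> 'a \<Rightarrow> 'a \<Rightarrow> 'a \<times> 'a" where
  "entry Forward q a = (q, a)"
| "entry Inverse q a = (a, q)"

fun asked :: "direction \<Rightarrow> ('a \<times> 'a) list \<Rightarrow> 'a set" where
  "asked Forward T = fst ` set T"
| "asked Inverse T = snd ` set T"

fun answered :: "direction \<Rightarrow> ('a \<times> 'a) list \<Rightarrow> 'a set" where
  "answered Forward T = snd ` set T"
| "answered Inverse T = fst ` set T"

definition partial_injection :: "('a \<times> 'a) list \<Rightarrow> bool"
  where "partial_injection T \<longleftrightarrow> distinct (map fst T) \<and> distinct (map snd T)"

definition consistent :: "('n bits \<times> 'n bits) list \<Rightarrow> ('n bits \<Rightarrow> 'n bits) set"
  where "consistent T = {R \<in> perms. \<forall>(x, y)\<in>set T. R x = y}"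

lemma partial_injection_entry:
  "\<lbrakk>partial_injection T; q \<notin> asked d T; a \<notin> answered d T\<rbrakk> \<Longrightarrow> partial_injection (entry d q a # T)"
  by (cases d) (auto simp: partial_injection_def)

lemma asked_entry: "q \<in> asked d T \<Longrightarrow> \<exists>a. entry d q a \<in> set T"
  by (cases d) force+

lemma card_unanswered:
  fixes T :: "('a::finite \<times> 'a) list"
  assumes "partial_injection T" "q \<notin> asked d T"
  shows "length T < CARD('a)" "real (card (- answered d T)) = real CARD('a) - real (length T)"
proof -
  have swap: "fst ` set (map prod.swap T) = snd ` set T" "snd ` set (map prod.swap T) = fst ` set T"
    "map fst (map prod.swap T) = map snd T" "map snd (map prod.swap T) = map fst T"
    by (simp_all add: image_image comp_def)
  show "length T < CARD('a)" "real (card (- answered d T)) = real CARD('a) - real (length T)"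
    using assms card_unused[of T q] card_unused[of "map prod.swap T" q, unfolded swap]
    by (cases d; simp add: partial_injection_def)+
qed

lemma directed_eq_iff:
  "R \<in> perms \<Longrightarrow> directed d R q = a \<longleftrightarrow> R (fst (entry d q a)) = snd (entry d q a)"
  by (cases d) (auto simp: perms_inv_eq_iff)

lemma consistent_entry:
  "consistent (entry d q a # T) = {R \<in> consistent T. directed d R q = a}"
  by (rule set_eqI) (auto simp: consistent_def case_prod_beta directed_eq_iff[symmetric])

lemma consistent_nonempty:
  assumes "partial_injection T"
  shows "consistent T \<noteq> {}"
proof -
  have "reprogram T id \<in> consistent T"
    using assms reprogram_consistent[of id T] by (auto simp: consistent_def perms_def partial_injection_def)
  then show ?thesis by blast
qed

lemma consistent_unanswered:
  assumes "R \<in> consistent T" "q \<notin> asked d T"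
  shows "directed d R q \<notin> answered d T"
proof
  assume "directed d R q \<in> answered d T"
  then show False
  proof (cases d)
    case Forward
    with \<open>directed d R q \<in> answered d T\<close> obtain x where "(x, R q) \<in> set T" by force
    moreover from this have "R x = R q" using assms(1) by (auto simp: consistent_def)
    ultimately show False using assms Forward by (force simp: consistent_def perms_def bij_def inj_eq)
  next
    case Inverse
    with \<open>directed d R q \<in> answered d T\<close> obtain y where "(inv R q, y) \<in> set T" by force
    moreover from this have "q = y" using assms(1) perms_inv_eq_iff[of R q "inv R q"] by (auto simp: consistent_def)
    ultimately show False using assms Inverse by force
  qed
qed

text \<open>Exchanging \<open>a\<close> and \<open>b\<close>, as values for a forward query and as
  arguments for an inverse one, is a bijection between the two sets, since neither occurs among the
  earlier answers.\<close>

lemma card_consistent_entry: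
  fixes T :: "('n::finite bits \<times> 'n bits) list"
  assumes "a \<notin> answered d T" "b \<notin> answered d T"
  shows "card (consistent (entry d q a # T)) = card (consistent (entry d q b # T))"
proof -
  define t :: "('n bits \<Rightarrow> 'n bits) \<Rightarrow> _" where "t = (\<lambda>R. case d of Forward \<Rightarrow> swap_pts a b \<circ> R | Inverse \<Rightarrow> R \<circ> swap_pts a b)"
  have tt: "t (t R) = R" for R
    by (cases d) (simp_all only: t_def direction.case comp_assoc[symmetric] transpose_comp_involutory id_comp,
      simp only: comp_assoc transpose_comp_involutory comp_id)
  have "t R \<in> consistent (entry d q b' # T)"
    if R: "R \<in> consistent (entry d q a' # T)" and ab: "{a', b'} = {a, b}" for R a' b'
  proof (cases d)
    case Forward
    have "swap_pts a b y = y" if "(x, y) \<in> set T" for x y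
      using that assms Forward by (intro transpose_apply_other) force+
    moreover have "swap_pts a b a' = b'" using ab by (auto simp: doubleton_eq_iff)
    ultimately show ?thesis using R
      by (auto simp: t_def Forward consistent_def swap_comp_in_perms)
  next
    case Inverse
    have "swap_pts a b x = x" if "(x, y) \<in> set T" for x y
      using that assms Inverse by (intro transpose_apply_other) force+
    moreover have "swap_pts a b b' = a'" using ab by (auto simp: doubleton_eq_iff)
    ultimately show ?thesis using R
      by (auto simp: t_def Inverse consistent_def comp_swap_in_perms)
  qed
  then have "bij_betw t (consistent (entry d q a # T)) (consistent (entry d q b # T))"
    by (intro bij_betw_byWitness[where f' = t]) (auto simp: tt)
  then show ?thesis by (rule bij_betw_same_card)
qed

lemma average_by_value:
  fixes f :: "'r \<Rightarrow> real"
  assumes "finite S" "S \<noteq> {}" "finite V" "g ` S \<subseteq> V"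
    and c: "\<And>v w. v \<in> V \<Longrightarrow> w \<in> V \<Longrightarrow> card {r \<in> S. g r = v} = card {r \<in> S. g r = w}"
  shows "(\<Sum>r\<in>S. f r) / card S = (\<Sum>v\<in>V. (\<Sum>r | r \<in> S \<and> g r = v. f r) / card {r \<in> S. g r = v}) / card V"
proof -
  obtain v0 where v0: "v0 \<in> V" using assms(2,4) by auto
  define m where "m = card {r \<in> S. g r = v0}"
  have m: "card {r \<in> S. g r = v} = m" if "v \<in> V" for v
    using c[OF that v0] by (simp add: m_def)
  have "(\<Sum>v\<in>V. card {r \<in> S. g r = v}) = card S"
    using sum.group[OF assms(1,3,4), of "\<lambda>_. 1::nat"] by simp
  then have "card S = card V * m" by (simp add: m)
  moreover have "(\<Sum>r\<in>S. f r) = (\<Sum>v\<in>V. \<Sum>r | r \<in> S \<and> g r = v. f r)"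
    using sum.group[OF assms(1,3,4), of f] by simp
  ultimately show ?thesis by (simp add: m sum_divide_distrib[symmetric])
qed

text \<open>Lazy sampling: all fresh answers are equally likely under a uniform consistent
  \<open>R\<close>, so the answer can be drawn first and the rest of \<open>R\<close>
  afterwards.\<close>

lemma average_consistent:
  fixes T :: "('n::finite bits \<times> 'n bits) list" and f :: "_ \<Rightarrow> real"
  assumes "partial_injection T" "q \<notin> asked d T"
  shows "(\<Sum>R\<in>consistent T. f R) / card (consistent T) =
    (\<Sum>a\<in>- answered d T. (\<Sum>R\<in>consistent (entry d q a # T). f R) / card (consistent (entry d q a # T)))
      / (real CARD('n bits) - real (length T))"
proof -
  have "(\<Sum>R\<in>consistent T. f R) / card (consistent T) =
    (\<Sum>a\<in>- answered d T. (\<Sum>R | R \<in> consistent T \<and> directed d R q = a. f R)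
      / card {R \<in> consistent T. directed d R q = a}) / card (- answered d T)"
  proof (rule average_by_value)
    show "consistent T \<noteq> {}" by (rule consistent_nonempty[OF assms(1)])
    show "(\<lambda>R. directed d R q) ` consistent T \<subseteq> - answered d T"
      using consistent_unanswered[OF _ assms(2)] by blast
    show "card {R \<in> consistent T. directed d R q = v} = card {R \<in> consistent T. directed d R q = w}"
      if "v \<in> - answered d T" "w \<in> - answered d T" for v w
      using card_consistent_entry[of v d T w q] that by (simp add: consistent_entry)
  qed (rule finite)+
  then show ?thesis
    by (simp only: consistent_entry card_unanswered(2)[OF assms])
qed

text \<open>
  \<open>ideal_value A T \<psi>\<close> and, below, \<open>real_value A T \<psi>\<close> are the total weights (over all \<open>P\<close>) with which
  \<open>A\<close> accepts if it is started in the state \<open>\<psi> P\<close> after the classical queries \<open>T\<close>. In the latter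
  the rest of the execution uses \<open>P\<close> reprogrammed to agree with \<open>T\<close> under a fresh key.
\<close>

definition ideal_value :: "('n::finite, 'w::finite) qalg \<Rightarrow> ('n bits \<times> 'n bits) list
    \<Rightarrow> (('n bits \<Rightarrow> 'n bits) \<Rightarrow> 'w state) \<Rightarrow> real"
  where "ideal_value A T \<psi> = (\<Sum>R\<in>consistent T. \<Sum>P\<in>perms. accept A R P (\<psi> P)) / card (consistent T)"

lemma ideal_value_repeated:
  assumes "entry d q a \<in> set T"
  shows "ideal_value (ClassicalQuery d q K) T \<psi> = ideal_value (K a) T \<psi>"
proof -
  have "directed d R q = a" if "R \<in> consistent T" for R
    using that assms by (cases d) (auto simp: consistent_def perms_inv_eq_iff)
  then show ?thesis by (simp add: ideal_value_def)
qed

lemma ideal_value_fresh: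
  fixes T :: "('n::finite bits \<times> 'n bits) list"
  assumes "partial_injection T" "q \<notin> asked d T"
  shows "ideal_value (ClassicalQuery d q K) T \<psi>
    = (\<Sum>a\<in>- answered d T. ideal_value (K a) (entry d q a # T) \<psi>) / (real CARD('n bits) - real (length T))"
proof -
  have "(\<Sum>R\<in>consistent (entry d q a # T). \<Sum>P\<in>perms. accept (ClassicalQuery d q K) R P (\<psi> P))
     = (\<Sum>R\<in>consistent (entry d q a # T). \<Sum>P\<in>perms. accept (K a) R P (\<psi> P))" for a
    by (simp add: consistent_entry)
  then show ?thesis
    unfolding ideal_value_def average_consistent[OF assms] by (simp del: accept.simps)
qed

section \<open>Reprogramming along a transcript and a key\<close>

text \<open>\<open>even_mansour k1 k2 P x = y\<close> holds exactly if
  \<open>P (x \<oplus> k1) = y \<oplus> k2\<close>, so this is the transcript translated into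
  conditions on \<open>P\<close>.\<close>

definition shift_keys :: "'n bits \<times> 'n bits \<Rightarrow> ('n bits \<times> 'n bits) list \<Rightarrow> ('n bits \<times> 'n bits) list"
  where "shift_keys k T = map (\<lambda>(x, y). (x \<oplus> fst k, y \<oplus> snd k)) T"

abbreviation keyed :: "'n bits \<times> 'n bits \<Rightarrow> ('n bits \<Rightarrow> 'n bits) \<Rightarrow> 'n bits \<Rightarrow> 'n bits"
  where "keyed k Q \<equiv> even_mansour (fst k) (snd k) Q"

lemma keyed_in_perms: "Q \<in> perms \<Longrightarrow> keyed k Q \<in> perms"
proof -
  assume "Q \<in> perms"
  then have "bij ((\<lambda>y. y \<oplus> snd k) \<circ> (Q \<circ> (\<lambda>x. x \<oplus> fst k)))"
    by (intro bij_comp bij_xor_bits) (simp add: perms_def)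
  also have "(\<lambda>y. y \<oplus> snd k) \<circ> (Q \<circ> (\<lambda>x. x \<oplus> fst k)) = keyed k Q"
    by (simp add: fun_eq_iff even_mansour_def)
  finally show ?thesis by (simp add: perms_def)
qed

lemma shift_keys_simps:
  "length (shift_keys k T) = length T"
  "fst ` set (shift_keys k T) = (\<lambda>x. x \<oplus> fst k) ` fst ` set T"
  "snd ` set (shift_keys k T) = (\<lambda>y. y \<oplus> snd k) ` snd ` set T"
  "map fst (shift_keys k T) = map (\<lambda>x. x \<oplus> fst k) (map fst T)"
  "map snd (shift_keys k T) = map (\<lambda>x. x \<oplus> snd k) (map snd T)"
  by (auto simp: shift_keys_def image_image case_prod_beta)

lemma distinct_shift_keys:
  assumes "partial_injection T"
  shows "distinct (map fst (shift_keys k T))" "distinct (map snd (shift_keys k T))"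
  using assms unfolding shift_keys_simps partial_injection_def distinct_map[of "\<lambda>x. x \<oplus> _"]
  by (auto intro: inj_onI)

lemma reprogram_in_perms: "P \<in> perms \<Longrightarrow> reprogram L P \<in> perms"
  by (simp add: perms_def)

lemma keyed_reprogram_consistent:
  assumes "partial_injection T" "P \<in> perms"
  shows "keyed k (reprogram (shift_keys k T) P) \<in> consistent T"
proof -
  have "keyed k (reprogram (shift_keys k T) P) x = y" if "(x, y) \<in> set T" for x y
  proof -
    have "(x \<oplus> fst k, y \<oplus> snd k) \<in> set (shift_keys k T)"
      using that by (force simp: shift_keys_def)
    from reprogram_consistent[OF _ distinct_shift_keys[OF assms(1)] this, of P] assms(2)
    show ?thesis by (simp add: even_mansour_def perms_def)
  qed
  then show ?thesis
    using assms by (auto simp: consistent_def keyed_in_perms reprogram_in_perms)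
qed

lemma keyed_reprogram_answer:
  assumes "partial_injection T" "P \<in> perms" "entry d q a \<in> set T"
  shows "directed d (keyed k (reprogram (shift_keys k T) P)) q = a"
  using keyed_reprogram_consistent[OF assms(1,2), of k] assms(3)
  by (cases d) (auto simp: consistent_def perms_inv_eq_iff)

locale uniform_keys =
  fixes D :: "('n::finite bits \<times> 'n bits) pmf"
  assumes fst_uniform: "map_pmf fst D = pmf_of_set UNIV"
    and snd_uniform: "map_pmf snd D = pmf_of_set UNIV"
begin

lemma expectation_uniform_part:
  assumes "map_pmf g D = pmf_of_set (UNIV :: 'n bits set)"
  shows "(\<Sum>k\<in>UNIV. pmf D k * h (g k)) = (\<Sum>a\<in>UNIV. h a) / real CARD('n bits)"
proof -
  have "(\<Sum>k\<in>UNIV. pmf D k * h (g k)) = measure_pmf.expectation D (\<lambda>k. h (g k))"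
    by (subst integral_measure_pmf_real[of UNIV]) (simp_all add: mult.commute)
  also have "\<dots> = measure_pmf.expectation (map_pmf g D) h" by simp
  also have "\<dots> = (\<Sum>a\<in>UNIV. h a) / real CARD('n bits)"
    by (simp add: assms integral_pmf_of_set)
  finally show ?thesis .
qed

lemma expectation_fst: "(\<Sum>k\<in>UNIV. pmf D k * h (x \<oplus> fst k)) = (\<Sum>a\<in>UNIV. h a) / real CARD('n bits)"
  using expectation_uniform_part[OF fst_uniform, of "\<lambda>a. h (x \<oplus> a)"]
    sum.reindex_bij_betw[OF bij_xor_bits(2), of h x] by simp

lemma expectation_snd: "(\<Sum>k\<in>UNIV. pmf D k * h (x \<oplus> snd k)) = (\<Sum>a\<in>UNIV. h a) / real CARD('n bits)"
  using expectation_uniform_part[OF snd_uniform, of "\<lambda>a. h (x \<oplus> a)"]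
    sum.reindex_bij_betw[OF bij_xor_bits(2), of h x] by simp

lemma sum_pmf_D: "(\<Sum>k\<in>UNIV. pmf D k) = 1"
  by (rule sum_pmf_eq_1) auto

definition real_value :: "('n, 'w::finite) qalg \<Rightarrow> ('n bits \<times> 'n bits) list
    \<Rightarrow> (('n bits \<Rightarrow> 'n bits) \<Rightarrow> 'w state) \<Rightarrow> real"
  where "real_value A T \<psi> = (\<Sum>k\<in>UNIV. pmf D k * (\<Sum>P\<in>perms.
    accept A (keyed k (reprogram (shift_keys k T) P)) (reprogram (shift_keys k T) P) (\<psi> P)))"

lemma real_value_repeated:
  assumes "partial_injection T" "entry d q a \<in> set T"
  shows "real_value (ClassicalQuery d q K) T \<psi> = real_value (K a) T \<psi>"
  unfolding real_value_def
  by (simp add: keyed_reprogram_answer[OF assms(1) _ assms(2)])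

lemma sum_shift_answers:
  fixes f :: "'n bits \<Rightarrow> real"
  shows "(\<Sum>v\<in>- (\<lambda>y. y \<oplus> c) ` Y. f v) = (\<Sum>y\<in>- Y. f (y \<oplus> c))"
proof -
  have "- (\<lambda>y. y \<oplus> c) ` Y = (\<lambda>y. y \<oplus> c) ` (- Y)"
    by (rule bij_image_Compl_eq[OF bij_xor_bits(1), symmetric])
  moreover have "inj_on (\<lambda>y. y \<oplus> c) (- Y)" by (rule inj_onI) simp
  ultimately show ?thesis by (simp add: sum.reindex)
qed

text \<open>Under the key \<open>k\<close> a forward query \<open>q\<close> reads the reprogrammed
  permutation at the uniform point \<open>q \<oplus> fst k\<close>, an inverse query reads its
  inverse at \<open>q \<oplus> snd k\<close>. Resampling that value prescribes a fresh answer
  \<open>a\<close>, and the run continues with \<open>K a\<close> and the extended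
  transcript.\<close>

lemma real_value_fresh:
  assumes T: "partial_injection T" "q \<notin> asked d T"
    and wf: "well_formed (ClassicalQuery d q K)"
    and deg: "perm_degree e \<psi>"
    and small: "e = 0 \<or> 10 * length T \<le> CARD('n bits)"
  shows "\<bar>real_value (ClassicalQuery d q K) T \<psi>
      - (\<Sum>a\<in>- answered d T. real_value (K a) (entry d q a # T) \<psi>) / (real CARD('n bits) - real (length T))\<bar>
    \<le> resample_error TYPE('n) e (length T) * total_weight \<psi>"
proof -
  let ?A = "ClassicalQuery d q K" and ?L = "\<lambda>k. shift_keys k T"
  let ?G = "\<lambda>k Q u. accept ?A (keyed k Q) Q u"
  let ?M = "real CARD('n bits) - real (length T)"
  have G: "0 \<le> ?G k Q u \<and> ?G k Q u \<le> (norm u)\<^sup>2" "\<bar>?G k Q u - ?G k Q v\<bar> \<le> norm (u - v) * (norm u + norm v)" for k Q u v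
    by (rule accept_bounds[OF wf] accept_diff[OF wf])+
  note L = distinct_shift_keys[OF T(1)] shift_keys_simps(1)
  have answer: "?G k (reprogram (shift_keys k (entry d q a # T)) P) u
     = accept (K a) (keyed k (reprogram (shift_keys k (entry d q a # T)) P)) (reprogram (shift_keys k (entry d q a # T)) P) u"
    if "P \<in> perms" "a \<notin> answered d T" for k P a u
    using keyed_reprogram_answer[OF partial_injection_entry[OF T that(2)] that(1), of d q a k] by simp
  have collect: "(\<Sum>k\<in>UNIV. pmf D k * ((\<Sum>P\<in>perms. \<Sum>a\<in>- answered d T. ?G k (reprogram (shift_keys k (entry d q a # T)) P) (\<psi> P)) / ?M))
     = (\<Sum>a\<in>- answered d T. real_value (K a) (entry d q a # T) \<psi>) / ?M"
  proof -
    have "(\<Sum>a\<in>- answered d T. real_value (K a) (entry d q a # T) \<psi>)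
      = (\<Sum>k\<in>UNIV. \<Sum>a\<in>- answered d T. pmf D k * (\<Sum>P\<in>perms. ?G k (reprogram (shift_keys k (entry d q a # T)) P) (\<psi> P)))"
      unfolding real_value_def by (subst sum.swap) (simp add: answer del: accept.simps)
    also have "\<dots> = (\<Sum>k\<in>UNIV. pmf D k * (\<Sum>P\<in>perms. \<Sum>a\<in>- answered d T. ?G k (reprogram (shift_keys k (entry d q a # T)) P) (\<psi> P)))"
      by (subst (2) sum.swap) (simp only: sum_distrib_left)
    finally show ?thesis
      by (simp only: sum_divide_distrib[symmetric] times_divide_eq_right)
  qed
  show ?thesis
  proof (cases d)
    case Forward
    have fresh: "q \<oplus> fst k \<notin> fst ` set (?L k)" for k
      using T(2) Forward by (simp add: shift_keys_simps inj_image_mem_iff[OF bij_is_inj[OF bij_xor_bits(1)]])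
    \<comment> \<open>The fresh value \<open>v\<close> of the permutation and the fresh answer
      \<open>a\<close> are related by \<open>v = a \<oplus> snd k\<close>.\<close>
    have "(\<Sum>v\<in>- snd ` set (?L k). ?G k (reprogram ((q \<oplus> fst k, v) # ?L k) P) u)
        = (\<Sum>a\<in>- answered d T. ?G k (reprogram (shift_keys k (entry d q a # T)) P) u)" for k P u
      unfolding shift_keys_simps sum_shift_answers by (simp add: Forward shift_keys_def)
    with resample_average[of ?G ?L "\<lambda>k. q \<oplus> fst k" "length T" "pmf D", OF G L(1,2) fresh L(3) pmf_nonneg expectation_fst deg small]
    show ?thesis
      by (simp only: collect) (simp only: real_value_def)
  next
    case Inverse
    have fresh: "q \<oplus> snd k \<notin> snd ` set (?L k)" for k
      using T(2) Inverse by (simp add: shift_keys_simps inj_image_mem_iff[OF bij_is_inj[OF bij_xor_bits(1)]])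
    have "(\<Sum>v\<in>- fst ` set (?L k). ?G k (reprogram ((v, q \<oplus> snd k) # ?L k) P) u)
        = (\<Sum>a\<in>- answered d T. ?G k (reprogram (shift_keys k (entry d q a # T)) P) u)" for k P u
      unfolding shift_keys_simps sum_shift_answers by (simp add: Inverse shift_keys_def)
    with resample_average_inverse[of ?G ?L "\<lambda>k. q \<oplus> snd k" "length T" "pmf D", OF G L(1,2) fresh L(3) pmf_nonneg expectation_snd deg small]
    show ?thesis
      by (simp only: collect) (simp only: real_value_def)
  qed
qed

text \<open>The answer changes only if the key shifts some pair of \<open>T\<close> onto the point
  \<open>u\<close> or onto its value \<open>P u\<close>. The union bound has two events of
  probability \<open>1 / CARD('n bits)\<close> per pair, since each key part is uniform.\<close>

lemma reprogrammed_probability: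
  assumes P: "P \<in> perms"
  shows "(\<Sum>k\<in>UNIV. pmf D k * (if directed d P z \<noteq> directed d (reprogram (shift_keys k T) P) z then 1 else 0))
    \<le> 2 * real (length T) / real CARD('n bits)"
proof -
  \<comment> \<open>In either direction the query concerns the pair \<open>(u, P u)\<close>.\<close>
  define u where "u = (case d of Forward \<Rightarrow> z | Inverse \<Rightarrow> inv P z)"
  have bP: "bij P" using P by (simp add: perms_def)
  have touched: "u \<in> fst ` set (shift_keys k T) \<or> P u \<in> snd ` set (shift_keys k T)"
    if "directed d P z \<noteq> directed d (reprogram (shift_keys k T) P) z" for k
  proof (rule ccontr)
    assume "\<not> ?thesis"
    then have "reprogram (shift_keys k T) P u = P u"
      using reprogram_unchanged[OF bP] by blast
    then show False
      using that perms_inv_eq_iff[OF P, of z u] perms_inv_eq_iff[OF reprogram_in_perms[OF P], of "shift_keys k T" z u]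
      by (cases d) (auto simp: u_def)
  qed
  have ind: "(if directed d P z \<noteq> directed d (reprogram (shift_keys k T) P) z then 1 else 0)
     \<le> (\<Sum>xy\<in>set T. (if fst xy \<oplus> fst k = u then 1 else 0) + (if snd xy \<oplus> snd k = P u then 1 else 0 :: real))" for k
  proof -
    let ?f = "\<lambda>xy. (if fst xy \<oplus> fst k = u then 1 else 0) + (if snd xy \<oplus> snd k = P u then 1 else 0 :: real)"
    show ?thesis
    proof (cases "directed d P z \<noteq> directed d (reprogram (shift_keys k T) P) z")
      case True
      from touched[OF this] have "\<exists>xy\<in>set T. fst xy \<oplus> fst k = u \<or> snd xy \<oplus> snd k = P u"
      proof
        assume "u \<in> fst ` set (shift_keys k T)"
        then obtain xy where "xy \<in> set T" "u = fst xy \<oplus> fst k"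
          unfolding shift_keys_simps image_image by (rule imageE)
        then show ?thesis by (intro bexI[of _ xy] disjI1) (simp_all only:)
      next
        assume "P u \<in> snd ` set (shift_keys k T)"
        then obtain xy where "xy \<in> set T" "P u = snd xy \<oplus> snd k"
          unfolding shift_keys_simps image_image by (rule imageE)
        then show ?thesis by (intro bexI[of _ xy] disjI2) (simp_all only:)
      qed
      then obtain xy where xy: "xy \<in> set T" "fst xy \<oplus> fst k = u \<or> snd xy \<oplus> snd k = P u" ..
      from xy(2) have "1 \<le> ?f xy" by (elim disjE) simp_all
      then have "1 \<le> (\<Sum>xy\<in>set T. ?f xy)"
        using member_le_sum[of xy "set T" ?f] xy(1) by simp
      then show ?thesis using True by simp
    qed (simp add: sum_nonneg)
  qed
  have "(\<Sum>k\<in>UNIV. pmf D k * (if directed d P z \<noteq> directed d (reprogram (shift_keys k T) P) z then 1 else 0))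
    \<le> (\<Sum>k\<in>UNIV. pmf D k * (\<Sum>xy\<in>set T. (if fst xy \<oplus> fst k = u then 1 else 0) + (if snd xy \<oplus> snd k = P u then 1 else 0)))"
    by (intro sum_mono mult_left_mono ind pmf_nonneg)
  also have "\<dots> = (\<Sum>xy\<in>set T. (\<Sum>k\<in>UNIV. pmf D k * (if fst xy \<oplus> fst k = u then 1 else 0))
      + (\<Sum>k\<in>UNIV. pmf D k * (if snd xy \<oplus> snd k = P u then 1 else 0)))"
    by (simp only: sum_distrib_left sum.swap[of _ UNIV "set T"] distrib_left sum.distrib)
  also have "\<dots> = (\<Sum>xy\<in>set T. 2 / real CARD('n bits))"
    unfolding expectation_fst[of "\<lambda>a. if a = u then 1 else 0"] expectation_snd[of "\<lambda>a. if a = P u then 1 else 0"]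
    by simp
  also have "\<dots> = real (card (set T)) * (2 / real CARD('n bits))" by simp
  also have "\<dots> \<le> real (length T) * (2 / real CARD('n bits))"
    by (intro mult_right_mono) (simp_all add: card_length)
  finally show ?thesis by (simp add: mult.commute)
qed

text \<open>This moves the switch over one quantum query: only this query is answered by
  \<open>P\<close> instead of the reprogrammed permutation, and the later oracles are the same. The
  mean square change is bounded by \<open>norm_query_diff_le\<close> and
  \<open>reprogrammed_probability\<close>.\<close>

lemma real_value_query:
  assumes reg: "disjoint_registers rx ry" and wf: "well_formed A"
  shows "\<bar>real_value (QuantumQuery d rx ry A) T \<psi> - real_value A T (\<lambda>P. query_unitary (directed d P) rx ry *v \<psi> P)\<bar>
    \<le> 2 * sqrt (8 * real (length T) / real CARD('n bits)) * total_weight \<psi>"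
proof -
  \<comment> \<open>The square of \<open>x\<close> is the factor 4 of
    \<open>norm_query_diff_le\<close> times the bound of \<open>reprogrammed_probability\<close>.
    With this choice both terms in \<open>diff\<close> average to at most \<open>x\<close> times the
    weight.\<close>
  define x where "x = sqrt (8 * real (length T) / real CARD('n bits))"
  let ?R = "\<lambda>k P. reprogram (shift_keys k T) P"
  let ?U = "\<lambda>P. query_unitary (directed d P) rx ry"
  let ?a = "\<lambda>k P u. accept A (keyed k (?R k P)) (?R k P) u"
  show ?thesis
  \<comment> \<open>With an empty transcript \<open>x\<close> is 0 and cannot be divided by, but
    then nothing is reprogrammed.\<close>
  proof (cases "T = []")
    case True
    then show ?thesis by (simp add: real_value_def shift_keys_def)
  next
    case False
    then have x: "x > 0" "x\<^sup>2 = 8 * real (length T) / real CARD('n bits)"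
      by (simp_all add: x_def)
    have diff: "\<bar>?a k P (?U (?R k P) *v \<psi> P) - ?a k P (?U P *v \<psi> P)\<bar>
      \<le> (norm (?U P *v \<psi> P - ?U (?R k P) *v \<psi> P))\<^sup>2 / x + x * (norm (\<psi> P))\<^sup>2" for k P
    proof -
      define a where "a = norm (?U P *v \<psi> P - ?U (?R k P) *v \<psi> P)"
      define b where "b = norm (\<psi> P)"
      have "\<bar>?a k P (?U (?R k P) *v \<psi> P) - ?a k P (?U P *v \<psi> P)\<bar> \<le> a * (b + b)"
        using accept_diff[OF wf, of "keyed k (?R k P)" "?R k P" "?U (?R k P) *v \<psi> P" "?U P *v \<psi> P"]
        by (simp add: norm_query_unitary[OF reg] a_def b_def norm_minus_commute)
      also have "\<dots> \<le> a\<^sup>2 / x + x * b\<^sup>2"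
      proof -
        have "0 \<le> (a - x * b)\<^sup>2 / x" using x by simp
        also have "\<dots> = a\<^sup>2 / x + x * b\<^sup>2 - a * (b + b)"
          using x(1) by (simp add: power2_eq_square field_simps)
        finally show ?thesis by simp
      qed
      finally show ?thesis by (simp add: a_def b_def)
    qed
    have changed: "(\<Sum>k\<in>UNIV. pmf D k * (norm (?U P *v \<psi> P - ?U (?R k P) *v \<psi> P))\<^sup>2) \<le> x\<^sup>2 * (norm (\<psi> P))\<^sup>2"
      if P: "P \<in> perms" for P
    proof -
      let ?i = "\<lambda>k t. if directed d P (t \<circ> rx) \<noteq> directed d (?R k P) (t \<circ> rx) then 1 else 0 :: real"
      have "(\<Sum>k\<in>UNIV. pmf D k * (norm (?U P *v \<psi> P - ?U (?R k P) *v \<psi> P))\<^sup>2)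
        \<le> (\<Sum>k\<in>UNIV. pmf D k * (4 * (\<Sum>t\<in>UNIV. if directed d P (t \<circ> rx) \<noteq> directed d (?R k P) (t \<circ> rx) then (norm (\<psi> P $ t))\<^sup>2 else 0)))"
        by (intro sum_mono mult_left_mono norm_query_diff_le[OF reg] pmf_nonneg)
      also have "\<dots> = (\<Sum>k\<in>UNIV. \<Sum>t\<in>UNIV. 4 * (norm (\<psi> P $ t))\<^sup>2 * (pmf D k * ?i k t))"
        unfolding sum_distrib_left by (intro sum.cong refl) simp
      also have "\<dots> = (\<Sum>t\<in>UNIV. 4 * (norm (\<psi> P $ t))\<^sup>2 * (\<Sum>k\<in>UNIV. pmf D k * ?i k t))"
        by (subst sum.swap) (simp only: sum_distrib_left)
      also have "\<dots> \<le> (\<Sum>t\<in>UNIV. 4 * (norm (\<psi> P $ t))\<^sup>2 * (2 * real (length T) / real CARD('n bits)))"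
        by (intro sum_mono mult_left_mono reprogrammed_probability[OF P]) simp
      also have "\<dots> = x\<^sup>2 * (\<Sum>t\<in>UNIV. (norm (\<psi> P $ t))\<^sup>2)"
        unfolding sum_distrib_left by (intro sum.cong refl) (simp add: x(2))
      also have "(\<Sum>t\<in>UNIV. (norm (\<psi> P $ t))\<^sup>2) = (norm (\<psi> P))\<^sup>2"
        by (simp add: norm_vec_def L2_set_def sum_nonneg)
      finally show ?thesis .
    qed
    have eq: "real_value (QuantumQuery d rx ry A) T \<psi> - real_value A T (\<lambda>P. ?U P *v \<psi> P) =
       (\<Sum>k\<in>UNIV. \<Sum>P\<in>perms. pmf D k * (?a k P (?U (?R k P) *v \<psi> P) - ?a k P (?U P *v \<psi> P)))"
      by (simp add: real_value_def sum_subtractf right_diff_distrib sum_distrib_left)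
    have "\<bar>real_value (QuantumQuery d rx ry A) T \<psi> - real_value A T (\<lambda>P. ?U P *v \<psi> P)\<bar>
      \<le> (\<Sum>k\<in>UNIV. \<Sum>P\<in>perms. \<bar>pmf D k * (?a k P (?U (?R k P) *v \<psi> P) - ?a k P (?U P *v \<psi> P))\<bar>)"
      unfolding eq by (intro order_trans[OF sum_abs] sum_mono sum_abs)
    also have "\<dots> \<le> (\<Sum>k\<in>UNIV. \<Sum>P\<in>perms. pmf D k * ((norm (?U P *v \<psi> P - ?U (?R k P) *v \<psi> P))\<^sup>2 / x + x * (norm (\<psi> P))\<^sup>2))"
      unfolding abs_mult abs_of_nonneg[OF pmf_nonneg] by (intro sum_mono mult_left_mono[OF diff pmf_nonneg])
    also have "\<dots> = (\<Sum>P\<in>perms. (\<Sum>k\<in>UNIV. pmf D k * (norm (?U P *v \<psi> P - ?U (?R k P) *v \<psi> P))\<^sup>2) / x + (\<Sum>k\<in>UNIV. pmf D k) * (x * (norm (\<psi> P))\<^sup>2))"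
      by (subst sum.swap) (simp only: distrib_left sum.distrib sum_divide_distrib sum_distrib_right times_divide_eq_right)
    also have "\<dots> \<le> (\<Sum>P\<in>perms. x\<^sup>2 * (norm (\<psi> P))\<^sup>2 / x + x * (norm (\<psi> P))\<^sup>2)"
      unfolding sum_pmf_D mult_1 using x(1) by (intro sum_mono add_right_mono divide_right_mono changed) simp_all
    also have "\<dots> = 2 * x * total_weight \<psi>"
      using x(1) by (simp add: total_weight_def sum_distrib_left power2_eq_square mult.assoc)
    finally show ?thesis by (simp only: x_def)
  qed
qed

end

section \<open>The hybrid argument\<close>

lemma resample_error_nonneg: "0 \<le> resample_error TYPE('n::finite) d j"
  by (simp add: resample_error_def)

lemma resample_error_mono:
  assumes "d \<le> d'" "j \<le> j'"
  shows "resample_error TYPE('n::finite) d j \<le> resample_error TYPE('n) d' j'"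
  unfolding resample_error_def using assms
  by (intro add_mono mult_left_mono real_sqrt_le_mono divide_right_mono mult_mono) simp_all

lemma sum_total_weight_measurement:
  assumes "complete_measurement m M"
  shows "(\<Sum>i<m. total_weight (\<lambda>P. M i *v \<psi> P)) = total_weight \<psi>"
  unfolding total_weight_def
  by (subst sum.swap) (simp add: complete_measurement_norm[OF assms])

context uniform_keys
begin

text \<open>Induction on the algorithm with fixed bounds \<open>J\<close> and \<open>Q\<close> for
  transcript length and degree, so that every classical query costs at most
  \<open>resample_error\<close> at \<open>Q\<close> and \<open>J\<close>, and every quantum query at
  most \<open>\<beta>\<close>. Measurements are free because the weights of the branches add up to
  that of \<open>\<psi>\<close>.\<close>

lemma ideal_real_diff:
  fixes J Q :: nat
  assumes small: "Q = 0 \<or> 10 * J \<le> CARD('n bits)"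
  defines "\<beta> \<equiv> 2 * sqrt (8 * real J / real CARD('n bits))"
  assumes "well_formed A" "makes_queries A qE qP" "partial_injection T" "perm_degree d \<psi>"
    and "length T + qE \<le> J" "d + qP \<le> Q"
  shows "\<bar>ideal_value A T \<psi> - real_value A T \<psi>\<bar>
    \<le> (real qE * resample_error TYPE('n) Q J + real qP * \<beta>) * total_weight \<psi>"
  using assms(3-)
proof (induction A arbitrary: qE qP T d \<psi>)
  case (Output b)
  have "ideal_value (Output b) T \<psi> = real_value (Output b) T \<psi>"
    using consistent_nonempty[OF Output.prems(3)]
    by (simp add: ideal_value_def real_value_def sum_distrib_right[symmetric] sum_pmf_D finite)
  then show ?case
    by (simp add: \<beta>_def resample_error_nonneg total_weight_nonneg)
next
  case (Measure m M K)
  let ?\<psi> = "\<lambda>i P. M i *v \<psi> P" and ?e = "real qE * resample_error TYPE('n) Q J + real qP * \<beta>"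
  have ideal: "ideal_value (Measure m M K) T \<psi> = (\<Sum>i<m. ideal_value (K i) T (?\<psi> i))"
    unfolding ideal_value_def sum_divide_distrib[symmetric]
    by (simp add: sum.swap[of _ "{..<m}"])
  have real: "real_value (Measure m M K) T \<psi> = (\<Sum>i<m. real_value (K i) T (?\<psi> i))"
    unfolding real_value_def by (simp add: sum.swap[of _ "{..<m}"] sum_distrib_left)
  have "\<bar>ideal_value (Measure m M K) T \<psi> - real_value (Measure m M K) T \<psi>\<bar>
    \<le> (\<Sum>i<m. \<bar>ideal_value (K i) T (?\<psi> i) - real_value (K i) T (?\<psi> i)\<bar>)"
    unfolding ideal real by (simp only: sum_subtractf[symmetric] sum_abs)
  also have "\<dots> \<le> (\<Sum>i<m. ?e * total_weight (?\<psi> i))"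
  proof (intro sum_mono)
    fix i assume "i \<in> {..<m}"
    then show "\<bar>ideal_value (K i) T (?\<psi> i) - real_value (K i) T (?\<psi> i)\<bar> \<le> ?e * total_weight (?\<psi> i)"
      using Measure.prems
      by (intro Measure.IH[of "K i" qE qP T d "?\<psi> i"] perm_degree_additive[where B = "\<lambda>u. M i *v u"])
        (auto simp: matrix_vector_right_distrib)
  qed
  also have "\<dots> = ?e * total_weight \<psi>"
    using Measure.prems sum_total_weight_measurement[of m M \<psi>] by (simp add: sum_distrib_left[symmetric])
  finally show ?case .
next
  case (ClassicalQuery dir q K)
  let ?A = "ClassicalQuery dir q K"
  let ?r = "resample_error TYPE('n) Q J"
  let ?S = "total_weight \<psi>"
  have qE: "real (qE - 1) = real qE - 1" "qE > 0" using ClassicalQuery.prems by auto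
  have IH: "\<bar>ideal_value (K a) T' \<psi> - real_value (K a) T' \<psi>\<bar> \<le> ((real qE - 1) * ?r + real qP * \<beta>) * ?S"
    if "partial_injection T'" "length T' \<le> Suc (length T)" for a T'
    unfolding qE(1)[symmetric]
    by (rule ClassicalQuery.IH[OF _ _ _ that(1)]) (use ClassicalQuery.prems that in auto)
  show ?case
  \<comment> \<open>A repeated query has its answer in \<open>T\<close> and costs nothing;
    \<open>T\<close> is not extended, which keeps it a partial injection.\<close>
  proof (cases "q \<in> asked dir T")
    case True
    from asked_entry[OF this] obtain a where a: "entry dir q a \<in> set T" ..
    have "\<bar>ideal_value ?A T \<psi> - real_value ?A T \<psi>\<bar> \<le> ((real qE - 1) * ?r + real qP * \<beta>) * ?S"
      unfolding ideal_value_repeated[OF a] real_value_repeated[OF ClassicalQuery.prems(3) a]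
      by (rule IH) (use ClassicalQuery.prems in auto)
    also have "\<dots> \<le> (real qE * ?r + real qP * \<beta>) * ?S"
      by (intro mult_right_mono total_weight_nonneg) (simp add: left_diff_distrib resample_error_nonneg)
    finally show ?thesis .
  next
    case False
    let ?M = "real CARD('n bits) - real (length T)"
    let ?V = "- answered dir T"
    note T = ClassicalQuery.prems(3) False
    have M: "?M > 0" "real (card ?V) = ?M"
      using card_unanswered[OF T] by simp_all
    let ?real = "(\<Sum>a\<in>?V. real_value (K a) (entry dir q a # T) \<psi>) / ?M"
    have "\<bar>(\<Sum>a\<in>?V. ideal_value (K a) (entry dir q a # T) \<psi>) - (\<Sum>a\<in>?V. real_value (K a) (entry dir q a # T) \<psi>)\<bar>
      \<le> (\<Sum>a\<in>?V. \<bar>ideal_value (K a) (entry dir q a # T) \<psi> - real_value (K a) (entry dir q a # T) \<psi>\<bar>)"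
      by (simp only: sum_subtractf[symmetric] sum_abs)
    also have "\<dots> \<le> (\<Sum>a\<in>?V. ((real qE - 1) * ?r + real qP * \<beta>) * ?S)"
      by (intro sum_mono IH partial_injection_entry[OF T]) simp_all
    also have "\<dots> = ?M * (((real qE - 1) * ?r + real qP * \<beta>) * ?S)"
      by (simp add: M)
    finally have "\<bar>ideal_value ?A T \<psi> - ?real\<bar> \<le> ((real qE - 1) * ?r + real qP * \<beta>) * ?S"
      using M(1) by (simp add: ideal_value_fresh[OF T] diff_divide_distrib[symmetric] abs_divide divide_le_eq mult.commute)
    moreover have "\<bar>real_value ?A T \<psi> - ?real\<bar> \<le> resample_error TYPE('n) d (length T) * ?S"
      by (rule real_value_fresh[OF T]) (use ClassicalQuery.prems small in auto)
    moreover have "resample_error TYPE('n) d (length T) * ?S \<le> ?r * ?S"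
      by (intro mult_right_mono resample_error_mono total_weight_nonneg) (use ClassicalQuery.prems in auto)
    ultimately have "\<bar>ideal_value ?A T \<psi> - real_value ?A T \<psi>\<bar> \<le> ((real qE - 1) * ?r + real qP * \<beta>) * ?S + ?r * ?S"
      by linarith
    then show ?thesis by (simp add: algebra_simps)
  qed
next
  case (QuantumQuery dir rx ry A)
  let ?A = "QuantumQuery dir rx ry A"
  let ?\<phi> = "\<lambda>P. query_unitary (directed dir P) rx ry *v \<psi> P"
  let ?r = "resample_error TYPE('n) Q J"
  let ?S = "total_weight \<psi>"
  have reg: "disjoint_registers rx ry" and wf: "well_formed A" and qP: "real (qP - 1) = real qP - 1"
    using QuantumQuery.prems by auto
  have "\<bar>ideal_value A T ?\<phi> - real_value A T ?\<phi>\<bar> \<le> (real qE * ?r + real (qP - 1) * \<beta>) * total_weight ?\<phi>"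
    by (rule QuantumQuery.IH[OF wf _ QuantumQuery.prems(3) perm_degree_query_unitary[OF QuantumQuery.prems(4) reg]])
      (use QuantumQuery.prems in auto)
  then have "\<bar>ideal_value A T ?\<phi> - real_value A T ?\<phi>\<bar> \<le> (real qE * ?r + (real qP - 1) * \<beta>) * ?S"
    by (simp only: total_weight_def norm_query_unitary[OF reg] qP)
  moreover have "ideal_value ?A T \<psi> = ideal_value A T ?\<phi>"
    by (simp add: ideal_value_def)
  moreover have "\<bar>real_value ?A T \<psi> - real_value A T ?\<phi>\<bar> \<le> 2 * sqrt (8 * real (length T) / real CARD('n bits)) * ?S"
    by (rule real_value_query[OF reg wf])
  moreover have "2 * sqrt (8 * real (length T) / real CARD('n bits)) * ?S \<le> \<beta> * ?S"
    unfolding \<beta>_def using QuantumQuery.prems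
    by (intro mult_right_mono mult_left_mono real_sqrt_le_mono divide_right_mono total_weight_nonneg) simp_all
  ultimately have "\<bar>ideal_value ?A T \<psi> - real_value ?A T \<psi>\<bar> \<le> (real qE * ?r + (real qP - 1) * \<beta>) * ?S + \<beta> * ?S"
    by linarith
  then show ?case by (simp add: algebra_simps)
qed

end

section \<open>From the hybrid bound to the stated inequality\<close>

lemma pmf_bind_uniform:
  "finite S \<Longrightarrow> S \<noteq> {} \<Longrightarrow> pmf (bind_pmf (pmf_of_set S) f) b = (\<Sum>x\<in>S. pmf (f x) b) / card S"
  by (simp add: pmf_bind integral_pmf_of_set)

theorem theorem1:
  fixes D :: "('n::finite bits \<times> 'n bits) pmf"
    and A :: "('n, 'w::finite) qalg"
    and qE qP :: nat
  assumes "map_pmf fst D = pmf_of_set UNIV"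
    and "map_pmf snd D = pmf_of_set UNIV"
    and "well_formed A"
    and "makes_queries A qE qP"
  shows "\<bar>pmf (real_experiment D A) True - pmf (ideal_experiment A) True\<bar>
    \<le> 10 * 2 powr (- real CARD('n) / 2) * (real qE * sqrt (real qP) + real qP * sqrt (real qE))"
proof -
  interpret uniform_keys D by unfold_locales (use assms in auto)
  define N where "N = real CARD('n bits)"
  let ?perms = "perms :: ('n bits \<Rightarrow> 'n bits) set"
  let ?\<psi> = "\<lambda>_ :: 'n bits \<Rightarrow> 'n bits. zero_state :: 'w state"
  have N1: "N \<ge> 1"
    using zero_less_card_finite[where 'a = "'n bits"] by (simp add: N_def Suc_le_eq)
  have "N = 2 powr real CARD('n)"
    by (simp add: N_def card_fun powr_realpow)
  then have "sqrt N = 2 powr (real CARD('n) / 2)"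
    using powr_half_sqrt[of N] N1 by (simp add: powr_powr)
  then have N_powr: "2 powr (- real CARD('n) / 2) = 1 / sqrt N"
    by (simp add: powr_minus_divide)
  have "id \<in> ?perms" by (simp add: perms_def)
  then have perms0: "?perms \<noteq> {}" "card ?perms \<noteq> 0" by auto
  have run: "pmf (run A O1 O2) True = accept A O1 O2 zero_state" for O1 O2
    unfolding run_def by (rule pmf_run_from[OF assms(3) norm_zero_state])
  have ideal: "pmf (ideal_experiment A) True = ideal_value A [] ?\<psi> / card ?perms"
    using perms0 by (simp add: ideal_experiment_def pmf_bind_uniform run ideal_value_def consistent_def sum_divide_distrib)
  have "pmf (real_experiment D A) True = (\<Sum>k\<in>UNIV. pmf D k * (\<Sum>P\<in>?perms. accept A (keyed k P) P zero_state) / card ?perms)"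
    unfolding real_experiment_def pmf_bind
    by (subst integral_measure_pmf[of UNIV]) (use perms0 in \<open>simp_all add: case_prod_beta pmf_bind_uniform run\<close>)
  then have real: "pmf (real_experiment D A) True = real_value A [] ?\<psi> / card ?perms"
    by (simp add: real_value_def shift_keys_def sum_divide_distrib)
  have weight: "total_weight ?\<psi> = card ?perms"
    by (simp add: total_weight_def norm_zero_state)
  have bound: "\<bar>pmf (real_experiment D A) True - pmf (ideal_experiment A) True\<bar>
    \<le> real qE * resample_error TYPE('n) qP qE + real qP * (2 * sqrt (8 * real qE / N))"
    if "qP = 0 \<or> 10 * qE \<le> CARD('n bits)"
  proof -
    have "\<bar>ideal_value A [] ?\<psi> - real_value A [] ?\<psi>\<bar>
      \<le> (real qE * resample_error TYPE('n) qP qE + real qP * (2 * sqrt (8 * real qE / N))) * card ?perms"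
      unfolding weight[symmetric] N_def
      by (rule ideal_real_diff[OF that assms(3,4) _ perm_degree_const[of 0]]) (simp_all add: partial_injection_def)
    moreover have "\<bar>pmf (real_experiment D A) True - pmf (ideal_experiment A) True\<bar>
       = \<bar>ideal_value A [] ?\<psi> - real_value A [] ?\<psi>\<bar> / card ?perms"
      by (simp add: ideal real diff_divide_distrib[symmetric] abs_divide abs_minus_commute)
    ultimately show ?thesis using perms0 by (simp add: divide_le_eq)
  qed
  define e where "e = real qE"
  define p where "p = real qP"
  have ep: "e \<ge> 0" "p \<ge> 0" by (simp_all add: e_def p_def)
  define B where "B = 10 / sqrt N * (e * sqrt p + p * sqrt e)"
  have "\<bar>pmf (real_experiment D A) True - pmf (ideal_experiment A) True\<bar> \<le> B"
  \<comment> \<open>Without queries of one kind \<open>bound\<close> gives zero, and for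
    \<open>B \<ge> 1\<close> the inequality is trivial for probabilities.\<close>
  proof (cases "qP = 0 \<or> qE = 0 \<or> B \<ge> 1")
    case True
    then consider "qP = 0" | "qE = 0" | "B \<ge> 1" by blast
    then show ?thesis
    proof cases
      case 1
      then show ?thesis using bound by (simp add: B_def p_def resample_error_def)
    next
      case 2
      then show ?thesis using bound by (simp add: B_def e_def)
    next
      case 3
      have "\<bar>pmf (real_experiment D A) True - pmf (ideal_experiment A) True\<bar> \<le> 1"
        using pmf_le_1[of "real_experiment D A" True] pmf_le_1[of "ideal_experiment A" True]
          pmf_nonneg[of "real_experiment D A" True] pmf_nonneg[of "ideal_experiment A" True] by linarith
      then show ?thesis using 3 by simp
    qed
  next
    case False
    then have ep1: "e \<ge> 1" "p \<ge> 1" and B1: "B < 1" by (auto simp: e_def p_def)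
    \<comment> \<open>Here \<open>B < 1\<close> forces \<open>u < 1 / 10\<close>. This yields the
      side condition of \<open>bound\<close> and makes the quadratic term small.\<close>
    define u where "u = e * sqrt p / sqrt N"
    have u0: "u \<ge> 0" using ep N1 by (simp add: u_def)
    have "10 * u \<le> B"
      using ep N1 by (simp add: u_def B_def field_simps)
    then have u1: "10 * u < 1" using B1 by simp
    have "10 * e \<le> 10 * u * sqrt N"
      using ep1 N1 by (simp add: u_def mult_le_cancel_left1)
    also have "\<dots> \<le> 1 * N"
    proof (intro mult_mono)
      show "sqrt N \<le> N" using N1 by (intro real_le_lsqrt) (simp_all add: power2_eq_square)
    qed (use u1 u0 N1 in simp_all)
    finally have "real (10 * qE) \<le> real CARD('n bits)" by (simp add: e_def N_def)
    then have "10 * qE \<le> CARD('n bits)" by (simp only: of_nat_le_iff)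
    then have "\<bar>pmf (real_experiment D A) True - pmf (ideal_experiment A) True\<bar>
      \<le> e * (2 * sqrt (80 * p / (9 * N)) + 36 * e * p / N) + p * (2 * sqrt (8 * e / N))"
      using bound by (simp add: resample_error_def e_def p_def N_def)
    also have "\<dots> \<le> e * (6 * (sqrt p / sqrt N)) + 36 * (u * u) + p * (6 * (sqrt e / sqrt N))"
    proof -
      \<comment> \<open>Both \<open>80 / 9\<close> and 8 are at most 9, whose root 3 doubles to
        6.\<close>
      have six: "2 * sqrt X \<le> 6 * (sqrt Y / sqrt N)" if "X \<le> 9 * (Y / N)" for X Y
      proof -
        have "sqrt 9 = 3" by (rule real_sqrt_unique) auto
        then show ?thesis
          using real_sqrt_le_mono[OF that] by (simp add: real_sqrt_mult real_sqrt_divide)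
      qed
      have "80 * p / (9 * N) \<le> 9 * (p / N)" "8 * e / N \<le> 9 * (e / N)"
        using ep N1 by (simp_all add: field_simps)
      from mult_left_mono[OF six[OF this(1)] ep(1)] mult_left_mono[OF six[OF this(2)] ep(2)]
      have "e * (2 * sqrt (80 * p / (9 * N))) + p * (2 * sqrt (8 * e / N))
        \<le> e * (6 * (sqrt p / sqrt N)) + p * (6 * (sqrt e / sqrt N))"
        by (rule add_mono)
      moreover have "u * u = e * e * p / N"
        using ep N1 by (simp add: u_def power2_eq_square[symmetric] power_divide power_mult_distrib)
      then have "e * (36 * e * p / N) = 36 * (u * u)" by simp
      ultimately show ?thesis unfolding distrib_left by linarith
    qed
    also have "\<dots> \<le> B"
    proof -
      define w where "w = p * (sqrt e / sqrt N)"
      have "w \<ge> 0" using ep N1 by (simp add: w_def)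
      \<comment> \<open>Hence \<open>36 * (u * u)\<close> is at most \<open>3.6 * u\<close>, and 6 +
        3.6 stays below the constant 10.\<close>
      moreover have "u * u \<le> 1 / 10 * u" using u0 u1 by (intro mult_right_mono) simp_all
      moreover have "e * (6 * (sqrt p / sqrt N)) = 6 * u" "p * (6 * (sqrt e / sqrt N)) = 6 * w"
        by (simp_all add: u_def w_def)
      moreover have "B = 10 * u + 10 * w"
        by (simp add: B_def u_def w_def distrib_left)
      moreover have "6 * u + 36 * (u * u) + 6 * w \<le> 10 * u + 10 * w"
        using calculation(1,2) u0 by linarith
      ultimately show ?thesis by (simp only:)
    qed
    finally show ?thesis .
  qed
  then show ?thesis
    by (simp only: B_def e_def p_def N_powr times_divide_eq_right mult_1_right)
qed

end
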